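(* Let $\Gamma$ be a normalized bridgeless metrized graph with $v$ vertices, $e$ edges and edge connectivity $\Lambda(\Gamma)$, and suppose all edge lengths are equal. Then $$\frac1{12}-\frac{v-1}{6e}+\frac{v-1}{3e\Lambda(\Gamma)}\ \ge\ \tau(\Gamma)\ \ge\ \frac1{12}-\frac{v-1}{6e}+\frac{v+6}{12v}\Big(\frac{v-1}{e}\Big)^2.$$ In particular, if $\Gamma$ is $n$-regular and $\Lambda(\Gamma)=n$, then $$\frac1{12}-\frac{(v-1)(n-2)}{3vn^2}\ \ge\ \tau(\Gamma)\ \ge\ \frac1{12}\Big(\frac ge\Big)^2+\frac1{2v}\Big(\frac{v-1}{e}\Big)^2,$$ where $g=e-v+1$.
   Context: A metrized graph is a finite connected graph (multiple edges and self-loops allowed) whose edges are identified with closed segments of positive lengths; its vertex set $V(\Gamma)$ is finite, nonempty and contains all points of valence $\neq2$; $v=\#V(\Gamma)$, $e$ the number of edges, $g=e-v+1$. $\Gamma$ is normalized if its total length is $1$, bridgeless if deleting the interior of any single edge leaves it connected, and $n$-regular if it has a vertex set with every vertex of valence $n$. $\Lambda(\Gamma)$ is the minimum number of edges whose deletion disconnects $\Gamma$. With $r(x,y)$ the effective resistance when each edge is a resistor of resistance equal to its length, $\tau(\Gamma)=\frac14\int_\Gamma(\frac{\partial}{\partial x}r(x,y))^2dx$ (independent of $y$). *)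

theory Defs
  imports "HOL-Analysis.Analysis" "Graph_Theory.Graph_Theory"
begin

text \<open>
  A metrized graph with a chosen vertex set is given by a finite multigraph \<open>G\<close> (parallel edges and
  self-loops allowed) and a length function \<open>L\<close>. The orientation that the type \<open>pre_digraph\<close> puts on
  an edge \<open>e\<close> has no meaning beyond fixing an identification of \<open>e\<close> with the segment \<open>[0, L e]\<close>, the
  tail being at \<open>0\<close> and the head at \<open>L e\<close>; connectedness is that of the underlying undirected graph
  (and includes that there is at least one vertex).
\<close>

locale metrized_graph = fin_digraph G
  for G :: "('a, 'b) pre_digraph" and L :: "'b weight_fun" +
  assumes connected_graph: "Digraph_Component.connected G"
    and length_pos: "e \<in> arcs G \<Longrightarrow> 0 < L e"

definition normalized :: "('a, 'b) pre_digraph \<Rightarrow> 'b weight_fun \<Rightarrow> bool" where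
  "normalized G L \<longleftrightarrow> (\<Sum>e\<in>arcs G. L e) = 1"

definition equal_lengths :: "('a, 'b) pre_digraph \<Rightarrow> 'b weight_fun \<Rightarrow> bool" where
  "equal_lengths G L \<longleftrightarrow> (\<forall>a\<in>arcs G. \<forall>b\<in>arcs G. L a = L b)"

definition bridgeless :: "('a, 'b) pre_digraph \<Rightarrow> bool" where
  "bridgeless G \<longleftrightarrow> (\<forall>e\<in>arcs G. Digraph_Component.connected (pre_digraph.del_arc G e))"

definition del_edges :: "('a, 'b) pre_digraph \<Rightarrow> 'b set \<Rightarrow> ('a, 'b) pre_digraph" where
  "del_edges G F = G\<lparr>arcs := arcs G - F\<rparr>"

text \<open>
  A graph with a single vertex cannot be disconnected by deleting edges. For it the infimum is taken
  over the empty set, which on \<^typ>\<open>nat\<close> gives \<open>0\<close>.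
\<close>

definition edge_connectivity :: "('a, 'b) pre_digraph \<Rightarrow> nat" where
  "edge_connectivity G =
     Inf {card F |F. F \<subseteq> arcs G \<and> \<not> Digraph_Component.connected (del_edges G F)}"


text \<open>
  Points of the metric space: the vertices, and for each edge \<open>e\<close> the interior points \<open>Inner e t\<close> at
  distance \<open>t\<close> from the tail along \<open>e\<close>.
\<close>

datatype ('a, 'b) point = Vertex 'a | Inner 'b real

definition points :: "('a, 'b) pre_digraph \<Rightarrow> 'b weight_fun \<Rightarrow> ('a, 'b) point set" where
  "points G L = Vertex ` verts G \<union> {Inner e t |e t. e \<in> arcs G \<and> 0 < t \<and> t < L e}"

definition edge_point ::
    "('a, 'b) pre_digraph \<Rightarrow> 'b weight_fun \<Rightarrow> 'b \<Rightarrow> real \<Rightarrow> ('a, 'b) point" where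
  "edge_point G L e t =
     (if t \<le> 0 then Vertex (tail G e) else if L e \<le> t then Vertex (head G e) else Inner e t)"

text \<open>A self-loop contributes \<open>2\<close> to the valence of its vertex.\<close>

fun valence :: "('a, 'b) pre_digraph \<Rightarrow> ('a, 'b) point \<Rightarrow> nat" where
  "valence G (Vertex u) = out_degree G u + in_degree G u"
| "valence G (Inner e t) = 2"

definition is_vertex_set ::
    "('a, 'b) pre_digraph \<Rightarrow> 'b weight_fun \<Rightarrow> ('a, 'b) point set \<Rightarrow> bool" where
  "is_vertex_set G L W \<longleftrightarrow>
     finite W \<and> W \<noteq> {} \<and> W \<subseteq> points G L \<and> {x \<in> points G L. valence G x \<noteq> 2} \<subseteq> W"

definition regular_graph :: "nat \<Rightarrow> ('a, 'b) pre_digraph \<Rightarrow> 'b weight_fun \<Rightarrow> bool" where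
  "regular_graph n G L \<longleftrightarrow> (\<exists>W. is_vertex_set G L W \<and> (\<forall>x\<in>W. valence G x = n))"


text \<open>
  The potential \<open>\<phi>\<close> of the circuit in which every edge \<open>e\<close> is a resistor of resistance \<open>L e\<close>, when a
  unit current enters at \<open>a\<close> and leaves at \<open>b\<close>: by Ohm's law the current through \<open>e\<close> from tail to
  head is \<open>(\<phi> (tail e) - \<phi> (head e)) / L e\<close>, and Kirchhoff's current law gives the net flow out of
  each vertex.
\<close>

definition unit_current_potential ::
    "('a, 'b) pre_digraph \<Rightarrow> 'b weight_fun \<Rightarrow> 'a \<Rightarrow> 'a \<Rightarrow> ('a \<Rightarrow> real) \<Rightarrow> bool" where
  "unit_current_potential G L a b \<phi> \<longleftrightarrow>
     (\<forall>u\<in>verts G.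
        (\<Sum>e\<in>out_arcs G u. (\<phi> (tail G e) - \<phi> (head G e)) / L e)
      - (\<Sum>e\<in>in_arcs G u. (\<phi> (tail G e) - \<phi> (head G e)) / L e)
      = (if u = a then 1 else 0) - (if u = b then 1 else 0))"

definition circuit_resistance ::
    "('a, 'b) pre_digraph \<Rightarrow> 'b weight_fun \<Rightarrow> 'a \<Rightarrow> 'a \<Rightarrow> real" where
  "circuit_resistance G L a b =
     (THE R. \<exists>\<phi>. unit_current_potential G L a b \<phi> \<and> R = \<phi> a - \<phi> b)"

text \<open>
  To speak of the resistance between arbitrary points, the vertex set is enlarged by a finite set \<open>S\<close>
  of points. An edge of the subdivided graph is a triple \<open>(e, s, t)\<close>, standing for the part of \<open>e\<close>
  between two consecutive cut points \<open>s < t\<close>; its length is \<open>t - s\<close>.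
\<close>

definition cut_points ::
    "'b weight_fun \<Rightarrow> ('a, 'b) point set \<Rightarrow> 'b \<Rightarrow> real set" where
  "cut_points L S e = {0, L e} \<union> {t. Inner e t \<in> S}"

definition subdivide ::
    "('a, 'b) pre_digraph \<Rightarrow> 'b weight_fun \<Rightarrow> ('a, 'b) point set
      \<Rightarrow> (('a, 'b) point, 'b \<times> real \<times> real) pre_digraph" where
  "subdivide G L S =
     \<lparr> verts = Vertex ` verts G \<union> S,
       arcs = {(e, s, t). e \<in> arcs G \<and> s \<in> cut_points L S e \<and> t \<in> cut_points L S e \<and> s < t
                 \<and> cut_points L S e \<inter> {s<..<t} = {}},
       tail = (\<lambda>(e, s, t). edge_point G L e s),
       head = (\<lambda>(e, s, t). edge_point G L e t) \<rparr>"

definition resistance ::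
    "('a, 'b) pre_digraph \<Rightarrow> 'b weight_fun \<Rightarrow> ('a, 'b) point \<Rightarrow> ('a, 'b) point \<Rightarrow> real" where
  "resistance G L x y =
     circuit_resistance (subdivide G L {x, y}) (\<lambda>(e, s, t). t - s) x y"

text \<open>
  The tau constant, with the base point \<open>y\<close> as an explicit parameter; its value is the same for all
  \<open>y \<in> points G L\<close>. At finitely many points (the two ends of an edge, and possibly \<open>y\<close> itself) the
  derivative need not exist; these do not affect the integrals.
\<close>

definition tau :: "('a, 'b) pre_digraph \<Rightarrow> 'b weight_fun \<Rightarrow> ('a, 'b) point \<Rightarrow> real" where
  "tau G L y =
     1 / 4 * (\<Sum>e\<in>arcs G.
       integral {0..L e} (\<lambda>t. (deriv (\<lambda>s. resistance G L (edge_point G L e s) y) t)\<^sup>2))"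

end

theory Submission
  imports Defs
begin

text \<open>
  Let \<open>M\<close> be the Green function of the circuit grounded at some vertex, \<open>K u = M u u\<close>, and let \<open>R\<close> be
  the effective resistance between vertices. On every edge the resistance to a fixed point is a
  quadratic polynomial, and integrating its squared derivative gives
  \<open>\<tau> = 1/4 D(K, K) + 1/12 (\<Sum>e. L e (1 - R e / L e)\<^sup>2)\<close>, where \<open>D\<close> is the Dirichlet form and \<open>R e\<close> the
  resistance between the ends of \<open>e\<close>. Foster's identity \<open>(\<Sum>e. R e / L e) = v - 1\<close> turns the second
  term into \<open>1/12 - (v - 1)/(6m)\<close>, for \<open>m\<close> edges, plus a sum of squares.

  The lower bound follows from the Cauchy-Schwarz inequality for that sum of squares, and from
  bounding \<open>D(K, K)\<close>, which is the energy of \<open>R(\<cdot>, y)\<close> for every vertex \<open>y\<close>, by the contribution of the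
  edges at \<open>y\<close>, averaged over \<open>y\<close>.

  For the upper bound, the combination of both terms that has to be estimated is four times the ratio
  of the number of spanning forests with two components to the number of spanning trees. The ratios
  of the graphs obtained by contracting one edge \<open>e\<close>, weighted by \<open>R e / L e\<close>, add up to \<open>v - 2\<close> times
  the ratio itself, and contraction does not create smaller cuts; so induction reduces the estimate to
  two vertices.
\<close>

section \<open>Semidefinite forms on functions\<close>

definition linear_functional :: "(('a \<Rightarrow> real) \<Rightarrow> real) \<Rightarrow> bool" where
  "linear_functional \<phi> \<longleftrightarrow> (\<forall>a f b g. \<phi> (\<lambda>x. a * f x + b * g x) = a * \<phi> f + b * \<phi> g)"

lemma linear_functionalD:
  "linear_functional \<phi> \<Longrightarrow> \<phi> (\<lambda>x. a * f x + b * g x) = a * \<phi> f + b * \<phi> g"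
  by (simp add: linear_functional_def)

lemma linear_functional_diff:
  assumes "linear_functional \<phi>" "linear_functional \<mu>"
  shows "linear_functional (\<lambda>f. \<phi> f - k * \<mu> f)"
  using assms by (simp add: linear_functional_def algebra_simps)

lemma linear_functional_eval_diff: "linear_functional (\<lambda>f. f a - f b)"
  by (simp add: linear_functional_def algebra_simps)

text \<open>Riesz representation for a form that may be degenerate, on a function space that may be
  infinite-dimensional: what counts is that the functional vanishes on the kernel. The induction on
  \<open>I\<close> adds one square at a time.\<close>

lemma riesz_semidefinite:
  fixes d :: "'i \<Rightarrow> ('a \<Rightarrow> real) \<Rightarrow> real"
  assumes "finite I"
    and "\<And>i. i \<in> I \<Longrightarrow> linear_functional (d i)" and "\<And>i. i \<in> I \<Longrightarrow> 0 < c i"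
    and "linear_functional \<phi>" and "\<And>f. (\<And>i. i \<in> I \<Longrightarrow> d i f = 0) \<Longrightarrow> \<phi> f = 0"
  obtains x where "\<And>f. \<phi> f = (\<Sum>i\<in>I. c i * d i x * d i f)"
proof -
  have "\<exists>x. \<forall>f. \<phi> f = (\<Sum>i\<in>I. c i * d i x * d i f)"
    using assms
  proof (induction I arbitrary: \<phi> rule: finite_induct)
    case empty
    then show ?case by simp
  next
    case (insert j I)
    have dj: "linear_functional (d j)" and cj: "0 < c j"
      using insert.prems by auto
    have dI: "linear_functional (d i)" "0 < c i" if "i \<in> I" for i
      using insert.prems that by auto
    note lam = linear_functionalD[OF insert.prems(3)]
    show ?case
    \<comment> \<open>The split is whether \<open>d j\<close> is independent of the earlier
      functionals: a \<open>w\<close> killed by all of them but not by \<open>d j\<close> lets the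
      value of \<open>d j\<close> be adjusted alone.\<close>
    proof (cases "\<exists>w. (\<forall>i\<in>I. d i w = 0) \<and> d j w \<noteq> 0")
      case True
      then obtain w where w: "\<And>i. i \<in> I \<Longrightarrow> d i w = 0" "d j w \<noteq> 0" by auto
      define k where "k = \<phi> w / d j w"
      have "\<exists>x. \<forall>f. \<phi> f - k * d j f = (\<Sum>i\<in>I. c i * d i x * d i f)"
      proof (rule insert.IH)
        fix f assume f: "\<And>i. i \<in> I \<Longrightarrow> d i f = 0"
        let ?h = "\<lambda>v. 1 * f v + (- d j f / d j w) * w v"
        have "\<phi> ?h = 0"
        proof (rule insert.prems(4))
          fix i assume i: "i \<in> insert j I"
          have "d i ?h = 1 * d i f + (- d j f / d j w) * d i w"
            by (rule linear_functionalD[OF insert.prems(1)[OF i]])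
          also have "\<dots> = 0"
            using f w i by auto
          finally show "d i ?h = 0" .
        qed
        then show "\<phi> f - k * d j f = 0"
          unfolding lam by (simp add: k_def)
      qed (use dI dj insert.prems(3) in \<open>auto intro: linear_functional_diff\<close>)
      then obtain x where x: "\<And>f. \<phi> f - k * d j f = (\<Sum>i\<in>I. c i * d i x * d i f)" by auto
      \<comment> \<open>The shift along \<open>w\<close> sets \<open>d j\<close> to
        \<open>k / c j\<close>, so the new square contributes exactly the subtracted
        \<open>k * d j f\<close>.\<close>
      let ?x = "\<lambda>v. 1 * x v + ((k / c j - d j x) / d j w) * w v"
      have "d i ?x = d i x" if "i \<in> I" for i
        by (rule trans[OF linear_functionalD[OF dI(1)[OF that]]]) (simp add: w(1)[OF that])
      moreover have "d j ?x = k / c j"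
        by (rule trans[OF linear_functionalD[OF dj]]) (simp add: w(2))
      ultimately have "\<phi> f = (\<Sum>i\<in>insert j I. c i * d i ?x * d i f)" for f
        using insert.hyps x[of f] cj by simp
      then show ?thesis by blast
    next
      case False
      have dj0: "d j f = 0" if "\<And>i. i \<in> I \<Longrightarrow> d i f = 0" for f
        using False that by blast
      have 1: "\<exists>x. \<forall>f. d j f = (\<Sum>i\<in>I. c i * d i x * d i f)"
        by (rule insert.IH) (use dj0 dI dj in auto)
      have 2: "\<exists>x. \<forall>f. \<phi> f = (\<Sum>i\<in>I. c i * d i x * d i f)"
      proof (rule insert.IH)
        fix f assume f: "\<And>i. i \<in> I \<Longrightarrow> d i f = 0"
        show "\<phi> f = 0"
          by (rule insert.prems(4)) (use f dj0[OF f] in auto)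
      qed (use dI insert.prems(3) in auto)
      obtain z where z: "\<And>f. d j f = (\<Sum>i\<in>I. c i * d i z * d i f)"
        using 1 by blast
      obtain x where x: "\<And>f. \<phi> f = (\<Sum>i\<in>I. c i * d i x * d i f)"
        using 2 by blast
      have pos: "0 \<le> d j z"
        unfolding z[of z] by (rule sum_nonneg) (auto simp: dI mult.assoc less_imp_le)
      \<comment> \<open>A rank-one update: over \<open>I\<close>, \<open>x + k z\<close> represents
        \<open>\<phi> + k * d j\<close>, and \<open>k\<close> is chosen so that the new square
        cancels the surplus. The denominator is positive since \<open>d j z\<close> is a sum of
        squares.\<close>
      define k where "k = - c j * d j x / (1 + c j * d j z)"
      have k: "k + c j * (d j x + k * d j z) = 0"
      proof -
        have "1 + c j * d j z > 0" using pos cj by (simp add: add_pos_nonneg)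
        then show ?thesis by (simp add: k_def field_simps)
      qed
      let ?x = "\<lambda>v. 1 * x v + k * z v"
      have dx: "d i ?x = d i x + k * d i z" if "i \<in> insert j I" for i
        by (rule trans[OF linear_functionalD[OF insert.prems(1)[OF that]]]) simp
      have "\<phi> f = (\<Sum>i\<in>insert j I. c i * d i ?x * d i f)" for f
      proof -
        have "(\<Sum>i\<in>I. c i * d i ?x * d i f) = \<phi> f + k * d j f"
        proof -
          have "(\<Sum>i\<in>I. c i * d i ?x * d i f) = (\<Sum>i\<in>I. c i * (d i x + k * d i z) * d i f)"
            by (intro sum.cong refl) (simp only: dx insertI2)
          then show ?thesis
            unfolding x[of f] z[of f] by (simp add: algebra_simps sum.distrib sum_distrib_left)
        qed
        then have "(\<Sum>i\<in>insert j I. c i * d i ?x * d i f)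
            = \<phi> f + k * d j f + c j * (d j x + k * d j z) * d j f"
          using insert.hyps by (simp only: sum.insert dx[OF insertI1] add.commute not_False_eq_True)
        also have "\<dots> = \<phi> f + (k + c j * (d j x + k * d j z)) * d j f"
          by (simp add: algebra_simps)
        finally have "(\<Sum>i\<in>insert j I. c i * d i ?x * d i f)
            = \<phi> f + (k + c j * (d j x + k * d j z)) * d j f" .
        then show ?thesis using k by simp
      qed
      then show ?thesis by blast
    qed
  qed
  then show thesis using that by blast
qed

section \<open>Green functions of weighted graphs\<close>

locale network =
  fixes V :: "'a set" and E :: "'b set" and src tgt :: "'b \<Rightarrow> 'a" and c :: "'b \<Rightarrow> real"
  assumes finite_V: "finite V" and finite_E: "finite E"
    and src_in [simp]: "e \<in> E \<Longrightarrow> src e \<in> V" and tgt_in [simp]: "e \<in> E \<Longrightarrow> tgt e \<in> V"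
    and c_pos: "e \<in> E \<Longrightarrow> 0 < c e"
begin

definition D :: "('a \<Rightarrow> real) \<Rightarrow> ('a \<Rightarrow> real) \<Rightarrow> real" where
  "D f g = (\<Sum>e\<in>E. c e * (f (tgt e) - f (src e)) * (g (tgt e) - g (src e)))"

lemma D_commute: "D f g = D g f"
  unfolding D_def by (simp add: mult_ac)

lemma D_add_left: "D (\<lambda>u. f u + g u) h = D f h + D g h"
  unfolding D_def sum.distrib[symmetric] by (rule sum.cong) (auto simp: algebra_simps)

lemma D_diff_left: "D (\<lambda>u. f u - g u) h = D f h - D g h"
  unfolding D_def sum_subtractf[symmetric] by (rule sum.cong) (auto simp: algebra_simps)

lemma D_scale_left: "D (\<lambda>u. k * f u) h = k * D f h"
  unfolding D_def sum_distrib_left by (rule sum.cong) (auto simp: algebra_simps)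

lemma D_add_right: "D h (\<lambda>u. f u + g u) = D h f + D h g"
  by (simp only: D_commute[of h] D_add_left)

lemma D_diff_right: "D h (\<lambda>u. f u - g u) = D h f - D h g"
  by (simp only: D_commute[of h] D_diff_left)

lemma D_scale_right: "D h (\<lambda>u. k * f u) = k * D h f"
  by (simp only: D_commute[of h] D_scale_left)

lemmas D_linear = D_add_left D_diff_left D_scale_left D_add_right D_diff_right D_scale_right

lemma D_cong:
  "(\<And>u. u \<in> V \<Longrightarrow> f u = f' u) \<Longrightarrow> (\<And>u. u \<in> V \<Longrightarrow> g u = g' u) \<Longrightarrow> D f g = D f' g'"
  unfolding D_def by (intro sum.cong) auto

lemma D_nonneg: "0 \<le> D f f"
  unfolding D_def by (intro sum_nonneg) (auto simp: mult.assoc less_imp_le[OF c_pos])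

lemma D_degenerate:
  assumes "D f f = 0"
  shows "D f g = 0"
proof -
  have "c e * (f (tgt e) - f (src e)) * (f (tgt e) - f (src e)) = 0" if "e \<in> E" for e
    using assms that finite_E unfolding D_def
    by (subst (asm) sum_nonneg_eq_0_iff) (auto simp: mult.assoc less_imp_le[OF c_pos])
  then show ?thesis
    unfolding D_def by (intro sum.neutral) auto
qed

text \<open>The trace of the Laplacian times the matrix \<open>X\<close>, regrouped by edges.
  Foster's identity and the edge expansion of the trace of \<open>M\<close> are two
  instances.\<close>

lemma sum_D_indicator:
  "(\<Sum>u\<in>V. D (X u) (\<lambda>w. of_bool (w = u)))
    = (\<Sum>e\<in>E. c e * (X (tgt e) (tgt e) - X (tgt e) (src e) - X (src e) (tgt e) + X (src e) (src e)))"
proof -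
  have "(\<Sum>u\<in>V. D (X u) (\<lambda>w. of_bool (w = u)))
      = (\<Sum>e\<in>E. \<Sum>u\<in>V. c e * (X u (tgt e) - X u (src e)) * (of_bool (tgt e = u) - of_bool (src e = u)))"
    unfolding D_def by (rule sum.swap)
  also have "\<dots> = (\<Sum>e\<in>E. (\<Sum>u\<in>V. if tgt e = u then c e * (X u (tgt e) - X u (src e)) else 0)
      - (\<Sum>u\<in>V. if src e = u then c e * (X u (tgt e) - X u (src e)) else 0))"
    unfolding sum_subtractf[symmetric] by (intro sum.cong refl) auto
  also have "\<dots> = (\<Sum>e\<in>E. c e * (X (tgt e) (tgt e) - X (tgt e) (src e) - X (src e) (tgt e) + X (src e) (src e)))"
    using finite_V by (intro sum.cong refl) (simp add: algebra_simps)
  finally show ?thesis .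
qed

end

text \<open>For the Green function \<open>M\<close> this is the weighted number of spanning forests with two
  components, divided by that of spanning trees: the two sums count such forests with a marked vertex
  and with a marked edge in the component that is not grounded, and a tree has one more vertex than
  edges.\<close>

definition forest_ratio ::
    "'a set \<Rightarrow> 'b set \<Rightarrow> ('b \<Rightarrow> 'a) \<Rightarrow> ('b \<Rightarrow> 'a) \<Rightarrow> ('b \<Rightarrow> real) \<Rightarrow> ('a \<Rightarrow> 'a \<Rightarrow> real) \<Rightarrow> real" where
  "forest_ratio V E src tgt c M =
     (\<Sum>u\<in>V. M u u) - (\<Sum>e\<in>E. c e * (M (src e) (src e) * M (tgt e) (tgt e) - (M (src e) (tgt e))\<^sup>2))"

text \<open>On \<open>V\<close>, \<open>M\<close> is the inverse of the Laplacian without the row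
  and column of \<open>ground\<close>, extended by zero. It is characterized weakly, by a
  reproducing property against all test functions \<open>f\<close>.\<close>

locale green_network = network V E src tgt c
  for V :: "'a set" and E :: "'b set" and src tgt :: "'b \<Rightarrow> 'a" and c :: "'b \<Rightarrow> real" +
  fixes ground :: 'a and M :: "'a \<Rightarrow> 'a \<Rightarrow> real"
  assumes root_in: "ground \<in> V"
    and green: "u \<in> V \<Longrightarrow> D (M u) f = f u - f ground"
    and green_root: "u \<in> V \<Longrightarrow> M u ground = 0"
begin

lemma M_commute:
  assumes "u \<in> V" "w \<in> V"
  shows "M u w = M w u"
  using green[OF assms(1), of "M w"] green[OF assms(2), of "M u"] green_root assms D_commute by simp

lemma M_root: "u \<in> V \<Longrightarrow> M ground u = 0"
  using M_commute[OF root_in, of u] green_root by simp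

definition R :: "'a \<Rightarrow> 'a \<Rightarrow> real" where
  "R u w = M u u - 2 * M u w + M w w"

lemma R_self [simp]: "R u u = 0"
  by (simp add: R_def)

lemma R_energy:
  assumes "u \<in> V" "w \<in> V"
  shows "D (\<lambda>x. M u x - M w x) (\<lambda>x. M u x - M w x) = R u w"
  using M_commute[OF assms] by (simp add: D_linear green assms green_root R_def)

lemma R_commute: "u \<in> V \<Longrightarrow> w \<in> V \<Longrightarrow> R u w = R w u"
  using M_commute[of u w] by (simp add: R_def)

text \<open>The potential of a unit current from \<open>u\<close> to \<open>w\<close> pairs to 1
  with the indicator of \<open>u\<close>, so its energy cannot vanish.\<close>

lemma R_pos:
  assumes "u \<in> V" "w \<in> V" "u \<noteq> w"
  shows "0 < R u w"
proof -
  let ?f = "\<lambda>x. M u x - M w x"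
  have "D ?f (\<lambda>x. of_bool (x = u)) = 1"
    using assms by (simp add: D_linear green)
  then have "D ?f ?f \<noteq> 0" using D_degenerate by fastforce
  then show ?thesis using D_nonneg[of ?f] R_energy[OF assms(1,2)] by simp
qed

lemma M_diag_nonneg: "u \<in> V \<Longrightarrow> 0 \<le> M u u"
  using D_nonneg[of "M u"] green[of u "M u"] green_root[of u] by simp

text \<open>Both sides are the trace of the Laplacian times \<open>M\<close>, whose diagonal is 1
  except for a 0 at \<open>ground\<close>.\<close>

lemma foster: "(\<Sum>e\<in>E. c e * R (src e) (tgt e)) = real (card V) - 1"
proof -
  have "(\<Sum>e\<in>E. c e * R (src e) (tgt e)) = (\<Sum>u\<in>V. D (M u) (\<lambda>w. of_bool (w = u)))"
    unfolding sum_D_indicator by (intro sum.cong refl) (simp add: R_def M_commute)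
  also have "\<dots> = (\<Sum>u\<in>V. 1 - of_bool (u = ground))"
    by (intro sum.cong) (auto simp: green)
  also have "\<dots> = real (card V) - 1"
    using finite_V root_in by (simp add: sum_subtractf of_bool_def)
  finally show ?thesis .
qed

text \<open>Foster's computation with the row of \<open>u\<close> weighted by \<open>M u u\<close>;
  the defect at \<open>ground\<close> disappears because its weight is 0.\<close>

lemma trace_M:
  "(\<Sum>u\<in>V. M u u) = (\<Sum>e\<in>E. c e * (M (tgt e) (tgt e) * (M (tgt e) (tgt e) - M (src e) (tgt e))
      + M (src e) (src e) * (M (src e) (src e) - M (src e) (tgt e))))"
proof -
  have "(\<Sum>e\<in>E. c e * (M (tgt e) (tgt e) * (M (tgt e) (tgt e) - M (src e) (tgt e))
      + M (src e) (src e) * (M (src e) (src e) - M (src e) (tgt e))))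
      = (\<Sum>u\<in>V. D (\<lambda>w. M u u * M u w) (\<lambda>w. of_bool (w = u)))"
    unfolding sum_D_indicator
    by (intro sum.cong refl) (simp add: M_commute algebra_simps)
  also have "\<dots> = (\<Sum>u\<in>V. M u u)"
    by (intro sum.cong) (auto simp: D_linear green green_root root_in)
  finally show ?thesis by simp
qed

text \<open>With the trace written over edges by \<open>trace_M\<close>, this is a polynomial
  identity edge by edge. It makes the forest ratio the one quantity that both bounds on tau have to
  estimate.\<close>

lemma forest_ratio_eq:
  "4 * forest_ratio V E src tgt c M = (\<Sum>e\<in>E. c e * (R (src e) (tgt e))\<^sup>2) + 3 * D (\<lambda>u. M u u) (\<lambda>u. M u u)"
  unfolding forest_ratio_def trace_M D_def R_def right_diff_distrib sum_distrib_left
    sum.distrib[symmetric] sum_subtractf[symmetric]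
  by (intro sum.cong refl) (simp add: algebra_simps power2_eq_square)

text \<open>Up to a constant, the resistance to \<open>y\<close> is
  \<open>M u u - 2 * M y u\<close>. By the reproducing property the cross term is
  \<open>- 4 * M y y\<close> and the square of \<open>2 * M y\<close> has energy
  \<open>4 * M y y\<close>, so they cancel.\<close>

lemma energy_resistance_profile:
  assumes "y \<in> V"
  shows "D (\<lambda>u. R u y) (\<lambda>u. R u y) = D (\<lambda>u. M u u) (\<lambda>u. M u u)"
proof -
  have "D (\<lambda>u. R u y) (\<lambda>u. R u y)
      = D (\<lambda>u. M u u - 2 * M y u + M y y) (\<lambda>u. M u u - 2 * M y u + M y y)"
    by (intro D_cong) (auto simp: R_def M_commute assms)
  also have "\<dots> = D (\<lambda>u. M u u - 2 * M y u) (\<lambda>u. M u u - 2 * M y u)"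
    unfolding D_def by simp
  also have "\<dots> = D (\<lambda>u. M u u) (\<lambda>u. M u u)"
    using assms root_in
    by (simp add: D_linear D_commute[of "\<lambda>u. M u u" "M y"] green green_root)
  finally show ?thesis .
qed

text \<open>The energy does not depend on the base point, so it may be averaged over all of \<open>V\<close>; for a
  given base point only the edges adjacent to it are kept.\<close>

lemma energy_lower_bound:
  "2 * (\<Sum>e\<in>E. c e * (R (src e) (tgt e))\<^sup>2) \<le> real (card V) * D (\<lambda>u. M u u) (\<lambda>u. M u u)"
proof -
  have "2 * (\<Sum>e\<in>E. c e * (R (src e) (tgt e))\<^sup>2)
      \<le> (\<Sum>e\<in>E. \<Sum>y\<in>V. c e * (R (tgt e) y - R (src e) y)\<^sup>2)"
    unfolding sum_distrib_left
  proof (rule sum_mono)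
    fix e assume e: "e \<in> E"
    show "2 * (c e * (R (src e) (tgt e))\<^sup>2) \<le> (\<Sum>y\<in>V. c e * (R (tgt e) y - R (src e) y)\<^sup>2)"
    proof (cases "src e = tgt e")
      case True
      then show ?thesis by simp
    next
      case False
      \<comment> \<open>The factor 2: at either end \<open>y\<close> of the edge the difference is
        \<open>R (src e) (tgt e)\<close> up to sign.\<close>
      have "2 * (c e * (R (src e) (tgt e))\<^sup>2) = (\<Sum>y\<in>{src e, tgt e}. c e * (R (tgt e) y - R (src e) y)\<^sup>2)"
        using False R_commute[of "src e" "tgt e"] e by simp
      also have "\<dots> \<le> (\<Sum>y\<in>V. c e * (R (tgt e) y - R (src e) y)\<^sup>2)"
        using e finite_V c_pos[OF e] by (intro sum_mono2) auto
      finally show ?thesis .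
    qed
  qed
  also have "\<dots> = (\<Sum>y\<in>V. D (\<lambda>u. R u y) (\<lambda>u. R u y))"
    unfolding D_def by (subst sum.swap) (simp add: power2_eq_square mult.assoc)
  also have "\<dots> = real (card V) * D (\<lambda>u. M u u) (\<lambda>u. M u u)"
    by (simp add: energy_resistance_profile)
  finally show ?thesis .
qed

end

section \<open>Contraction of edges\<close>

context green_network
begin

text \<open>This is \<open>R a b\<close> times the forest ratio of the network in which \<open>a\<close> and \<open>b\<close> are identified. In
  this form it is polynomial in \<open>M\<close>, and the division by \<open>R a b\<close> is avoided.\<close>

definition contraction_value :: "'a \<Rightarrow> 'a \<Rightarrow> real" where
  "contraction_value a b =
     R a b * (\<Sum>u\<in>V. M u u) - (\<Sum>u\<in>V. (M a u - M b u)\<^sup>2) - (M a a * M b b - (M a b)\<^sup>2)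
     - (\<Sum>e\<in>E. c e * (R a b * (M (src e) (src e) * M (tgt e) (tgt e) - (M (src e) (tgt e))\<^sup>2)
          - ((M a (src e) - M b (src e))\<^sup>2 * M (tgt e) (tgt e)
             - 2 * (M a (src e) - M b (src e)) * (M a (tgt e) - M b (tgt e)) * M (src e) (tgt e)
             + (M a (tgt e) - M b (tgt e))\<^sup>2 * M (src e) (src e))))"

lemma contraction_value_self [simp]: "contraction_value a a = 0"
  by (simp add: contraction_value_def power2_eq_square)

lemma contraction_value_commute:
  assumes "a \<in> V" "b \<in> V"
  shows "contraction_value a b = contraction_value b a"
  unfolding contraction_value_def R_commute[OF assms] M_commute[OF assms]
    power2_commute[of "M a _"]
  by (simp add: algebra_simps)

text \<open>\<open>M'\<close> subtracts from \<open>M u\<close> the multiple of the unit potential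
  from \<open>a\<close> to \<open>b\<close> that equalizes its values at \<open>a\<close> and
  \<open>b\<close>, so it factors through the identification \<open>\<pi>\<close>. The merged vertex
  is called \<open>a\<close>; \<open>b \<noteq> ground\<close> lets the ground survive.\<close>

lemma contraction:
  assumes ab: "a \<in> V" "b \<in> V" "a \<noteq> b" "b \<noteq> ground"
  defines "\<pi> \<equiv> \<lambda>w. if w = b then a else w"
    and "M' \<equiv> \<lambda>u w. M u w - (M a u - M b u) * (M a w - M b w) / R a b"
  shows "green_network (V - {b}) E (\<pi> \<circ> src) (\<pi> \<circ> tgt) c ground M'" (is ?green)
    and "R a b * forest_ratio (V - {b}) E (\<pi> \<circ> src) (\<pi> \<circ> tgt) c M' = contraction_value a b" (is ?ratio)
proof -
  interpret N: network "V - {b}" E "\<pi> \<circ> src" "\<pi> \<circ> tgt" c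
    using ab finite_V finite_E c_pos by unfold_locales (auto simp: \<pi>_def)
  have Rpos: "R a b > 0" using R_pos ab by simp
  have M'b: "M' u b = M' u a" if "u \<in> V" for u
  proof -
    have "(M a u - M b u) = M u a - M u b" "M a a - M b a - (M a b - M b b) = R a b"
      using ab that by (auto simp: M_commute[of _ u] R_def M_commute[of b a])
    moreover have "M' u a - M' u b = M u a - M u b
        - (M a u - M b u) * (M a a - M b a - (M a b - M b b)) / R a b"
      by (simp add: M'_def algebra_simps diff_divide_distrib add_divide_distrib)
    ultimately show ?thesis using Rpos by simp
  qed
  have M'_commute: "M' u w = M' w u" if "u \<in> V" "w \<in> V" for u w
    using that M_commute by (simp add: M'_def mult.commute)
  have M'\<pi>: "M' u (\<pi> w) = M' u w" if "u \<in> V" for u w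
    using M'b that by (simp add: \<pi>_def)
  have M'\<pi>\<pi>: "M' (\<pi> u) (\<pi> w) = M' u w" if "u \<in> V" "w \<in> V" for u w
    using that ab M'\<pi> M'_commute by (metis (no_types, lifting) \<pi>_def)
  have ND: "N.D f h = D (f \<circ> \<pi>) (h \<circ> \<pi>)" for f h
    unfolding N.D_def D_def by simp
  show ?green
  proof unfold_locales
    show "ground \<in> V - {b}" using ab root_in by simp
  next
    fix u f assume u: "u \<in> V - {b}"
    have "N.D (M' u) f = D (M' u) (f \<circ> \<pi>)"
      unfolding ND using u M'\<pi> by (intro D_cong) auto
    also have "\<dots> = D (\<lambda>w. M u w - (M a u - M b u) / R a b * (M a w - M b w)) (f \<circ> \<pi>)"
      by (simp add: M'_def)
    also have "\<dots> = D (M u) (f \<circ> \<pi>) - (M a u - M b u) / R a b * (D (M a) (f \<circ> \<pi>) - D (M b) (f \<circ> \<pi>))"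
      by (simp only: D_diff_left D_scale_left)
    also have "\<dots> = f u - f ground"
      using u ab by (simp add: green \<pi>_def)
    finally show "N.D (M' u) f = f u - f ground" .
  next
    fix u assume "u \<in> V - {b}"
    then show "M' u ground = 0" using ab by (simp add: M'_def green_root)
  qed
  let ?g = "\<lambda>u. M a u - M b u"
  have scale: "R a b * M' u w = R a b * M u w - ?g u * ?g w" for u w
    using Rpos by (simp add: M'_def field_simps)
  \<comment> \<open>The diagonal entry of the removed vertex \<open>b\<close>; it produces the
    determinant of \<open>M\<close> on \<open>{a, b}\<close> in
    \<open>contraction_value\<close>.\<close>
  have bb: "R a b * M b b - (?g b)\<^sup>2 = M a a * M b b - (M a b)\<^sup>2"
    using ab by (simp add: R_def M_commute[of b a] power2_eq_square algebra_simps)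
  have "R a b * (\<Sum>u\<in>V - {b}. M' u u) = (\<Sum>u\<in>V - {b}. R a b * M u u - (?g u)\<^sup>2)"
    by (simp add: sum_distrib_left scale power2_eq_square)
  also have "\<dots> = (\<Sum>u\<in>V. R a b * M u u - (?g u)\<^sup>2) - (M a a * M b b - (M a b)\<^sup>2)"
    using ab finite_V by (simp add: sum_diff1 bb)
  finally have 1: "R a b * (\<Sum>u\<in>V - {b}. M' u u)
      = R a b * (\<Sum>u\<in>V. M u u) - (\<Sum>u\<in>V. (?g u)\<^sup>2) - (M a a * M b b - (M a b)\<^sup>2)"
    by (simp add: sum_subtractf sum_distrib_left)
  \<comment> \<open>Under a rank-one update the fourth-order terms of a 2 by 2 determinant cancel,
    so one factor \<open>R a b\<close> clears all denominators.\<close>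
  have det: "R a b * (M' t t * M' h h - (M' t h)\<^sup>2)
      = R a b * (M t t * M h h - (M t h)\<^sup>2)
        - ((?g t)\<^sup>2 * M h h - 2 * ?g t * ?g h * M t h + (?g h)\<^sup>2 * M t t)" for t h
    using Rpos by (simp add: M'_def field_simps power2_eq_square)
  have "R a b * (\<Sum>e\<in>E. c e * (M' ((\<pi> \<circ> src) e) ((\<pi> \<circ> src) e) * M' ((\<pi> \<circ> tgt) e) ((\<pi> \<circ> tgt) e)
        - (M' ((\<pi> \<circ> src) e) ((\<pi> \<circ> tgt) e))\<^sup>2))
      = (\<Sum>e\<in>E. c e * (R a b * (M' (src e) (src e) * M' (tgt e) (tgt e) - (M' (src e) (tgt e))\<^sup>2)))"
    unfolding sum_distrib_left by (intro sum.cong refl) (simp add: M'\<pi>\<pi>)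
  then show ?ratio
    unfolding forest_ratio_def contraction_value_def right_diff_distrib[of "R a b" "sum _ _"] 1 det
    by simp
qed

text \<open>The matrix identity \<open>M * Laplacian * M = M\<close>. It evaluates the corrections
  caused by a contraction once they are averaged over the contracted edge.\<close>

lemma sum_green_differences:
  assumes "u \<in> V" "w \<in> V"
  shows "(\<Sum>e\<in>E. c e * ((M (src e) u - M (tgt e) u) * (M (src e) w - M (tgt e) w))) = M u w"
proof -
  have "(\<Sum>e\<in>E. c e * ((M (src e) u - M (tgt e) u) * (M (src e) w - M (tgt e) w))) = D (M u) (M w)"
    unfolding D_def
    by (intro sum.cong refl) (simp add: M_commute[OF assms(1)] M_commute[OF assms(2)] algebra_simps)
  then show ?thesis using green[OF assms(1), of "M w"] green_root[OF assms(2)] M_commute assms by simp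
qed

text \<open>A two-component spanning forest has \<open>card V - 2\<close> edges, and each of them
  counts it once among the contractions. In the algebra, with
  \<open>forest_ratio = T - \<Delta>\<close>, Foster's identity gives
  \<open>(card V - 1) * (T - \<Delta>)\<close>, and the other terms add
  \<open>- T - \<Delta> + 2 * \<Delta>\<close>.\<close>

lemma contraction_identity:
  "(\<Sum>e\<in>E. c e * contraction_value (src e) (tgt e)) = (real (card V) - 2) * forest_ratio V E src tgt c M"
proof -
  define T where "T = (\<Sum>u\<in>V. M u u)"
  define \<delta> where "\<delta> f = M (src f) (src f) * M (tgt f) (tgt f) - (M (src f) (tgt f))\<^sup>2" for f
  define \<Delta> where "\<Delta> = (\<Sum>e\<in>E. c e * \<delta> e)"
  define \<gamma> where "\<gamma> e u = M (src e) u - M (tgt e) u" for e u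
  have gg: "(\<Sum>e\<in>E. c e * (\<gamma> e u * \<gamma> e w)) = M u w" if "u \<in> V" "w \<in> V" for u w
    unfolding \<gamma>_def by (rule sum_green_differences[OF that])
  define \<alpha> where "\<alpha> e f = (\<gamma> e (src f) * \<gamma> e (src f)) * M (tgt f) (tgt f)
             - 2 * ((\<gamma> e (src f) * \<gamma> e (tgt f)) * M (src f) (tgt f))
             + (\<gamma> e (tgt f) * \<gamma> e (tgt f)) * M (src f) (src f)" for e f
  have 1: "(\<Sum>e\<in>E. c e * (\<Sum>u\<in>V. \<gamma> e u * \<gamma> e u)) = T"
    unfolding sum_distrib_left T_def by (subst sum.swap) (simp add: gg)
  \<comment> \<open>Averaging over \<open>e\<close> turns each product of two
    \<open>\<gamma> e\<close> into an entry of \<open>M\<close>, and the correction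
    \<open>\<alpha>\<close> into twice the determinant \<open>\<delta> f\<close>.\<close>
  have 2: "(\<Sum>e\<in>E. c e * \<alpha> e f) = 2 * \<delta> f" if "f \<in> E" for f
  proof -
    have "(\<Sum>e\<in>E. c e * \<alpha> e f) = (\<Sum>e\<in>E. c e * (\<gamma> e (src f) * \<gamma> e (src f))) * M (tgt f) (tgt f)
             - 2 * ((\<Sum>e\<in>E. c e * (\<gamma> e (src f) * \<gamma> e (tgt f))) * M (src f) (tgt f))
             + (\<Sum>e\<in>E. c e * (\<gamma> e (tgt f) * \<gamma> e (tgt f))) * M (src f) (src f)"
      unfolding \<alpha>_def
      by (simp add: sum_distrib_left sum_distrib_right sum.distrib sum_subtractf algebra_simps)
    also have "\<dots> = 2 * \<delta> f"
      using that by (simp add: gg \<delta>_def power2_eq_square)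
    finally show ?thesis .
  qed
  have 3: "(\<Sum>e\<in>E. c e * (\<Sum>f\<in>E. c f * \<alpha> e f)) = 2 * \<Delta>"
  proof -
    have "(\<Sum>e\<in>E. c e * (\<Sum>f\<in>E. c f * \<alpha> e f)) = (\<Sum>f\<in>E. \<Sum>e\<in>E. c f * (c e * \<alpha> e f))"
      unfolding sum_distrib_left by (subst sum.swap) (simp add: mult.left_commute)
    also have "\<dots> = 2 * \<Delta>"
      unfolding \<Delta>_def sum_distrib_left by (intro sum.cong refl) (simp add: 2 flip: sum_distrib_left)
    finally show ?thesis .
  qed
  have "contraction_value (src e) (tgt e)
      = R (src e) (tgt e) * (T - \<Delta>) - (\<Sum>u\<in>V. \<gamma> e u * \<gamma> e u) - \<delta> e + (\<Sum>f\<in>E. c f * \<alpha> e f)" for e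
    unfolding contraction_value_def T_def \<Delta>_def \<delta>_def \<alpha>_def \<gamma>_def
    by (simp add: sum_distrib_left sum.distrib sum_subtractf algebra_simps power2_eq_square)
  then have "(\<Sum>e\<in>E. c e * contraction_value (src e) (tgt e))
      = (\<Sum>e\<in>E. c e * R (src e) (tgt e)) * (T - \<Delta>) - (\<Sum>e\<in>E. c e * (\<Sum>u\<in>V. \<gamma> e u * \<gamma> e u))
        - \<Delta> + (\<Sum>e\<in>E. c e * (\<Sum>f\<in>E. c f * \<alpha> e f))"
    by (simp add: \<Delta>_def right_diff_distrib distrib_left sum.distrib sum_subtractf
        sum_distrib_right mult.assoc)
  also have "\<dots> = (real (card V) - 2) * (T - \<Delta>)"
    unfolding foster 1 3 by (simp add: algebra_simps)
  also have "T - \<Delta> = forest_ratio V E src tgt c M"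
    by (simp add: forest_ratio_def T_def \<Delta>_def \<delta>_def)
  finally show ?thesis .
qed

end

text \<open>For more than two vertices, the induction hypothesis for the contractions is summed with
  weights \<open>c e * R (src e) (tgt e)\<close>. Foster's identity evaluates the right side,
  \<open>contraction_identity\<close> the left, and the factor \<open>card V - 2\<close>
  cancels.\<close>

theorem forest_ratio_cut_bound:
  assumes "green_network V E src tgt c ground M"
    and "\<And>S. S \<subseteq> V \<Longrightarrow> S \<noteq> {} \<Longrightarrow> S \<noteq> V \<Longrightarrow> lam \<le> (\<Sum>e | e \<in> E \<and> (src e \<in> S) \<noteq> (tgt e \<in> S). c e)"
  shows "lam * forest_ratio V E src tgt c M \<le> real (card V) - 1"
  using assms
proof (induction "card V" arbitrary: V src tgt M rule: less_induct)
  case less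
  interpret green_network V E src tgt c ground M by fact
  consider "card V = 0" | "card V = 1" | "card V = 2" | "card V > 2" by linarith
  then show ?case
  proof cases
    case 1
    then show ?thesis using root_in finite_V by auto
  next
    case 2
    then have V: "V = {ground}" using root_in by (auto simp: card_1_singleton_iff)
    have "forest_ratio V E src tgt c M = 0"
      using V green_root src_in tgt_in unfolding forest_ratio_def
      by (auto intro!: sum.neutral)
    then show ?thesis using 2 by simp
  next
    case 3
    then obtain p where V: "V = {ground, p}" and p: "p \<noteq> ground"
      using root_in by (auto simp: card_2_iff doubleton_eq_iff)
    have zero: "M ground ground = 0" "M ground p = 0" "M p ground = 0"
      using V M_root green_root by auto
    have "M (src e) (src e) * M (tgt e) (tgt e) - (M (src e) (tgt e))\<^sup>2 = 0" if "e \<in> E" for e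
      using src_in[OF that] tgt_in[OF that] zero unfolding V by (auto simp: power2_eq_square)
    then have ratio: "forest_ratio V E src tgt c M = M p p"
      unfolding forest_ratio_def using V p zero by simp
    define C where "C = (\<Sum>e | e \<in> E \<and> (src e \<in> {p}) \<noteq> (tgt e \<in> {p}). c e)"
    \<comment> \<open>Testing with the indicator of \<open>p\<close> gives
      \<open>C * M p p = 1\<close>: the forest ratio is the reciprocal of the only cut.\<close>
    have "D (M p) (\<lambda>w. of_bool (w = p)) = C * M p p"
      unfolding D_def C_def sum_distrib_right
    proof (intro sum.mono_neutral_cong_right finite_E)
      show "\<forall>e\<in>E - {e. e \<in> E \<and> (src e \<in> {p}) \<noteq> (tgt e \<in> {p})}.
          c e * (M p (tgt e) - M p (src e)) * (of_bool (tgt e = p) - of_bool (src e = p)) = 0"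
        by auto
      fix e assume e: "e \<in> {e. e \<in> E \<and> (src e \<in> {p}) \<noteq> (tgt e \<in> {p})}"
      then have "src e = p \<and> tgt e = ground \<or> src e = ground \<and> tgt e = p"
        using src_in[of e] tgt_in[of e] V by auto
      then show "c e * (M p (tgt e) - M p (src e)) * (of_bool (tgt e = p) - of_bool (src e = p))
          = c e * M p p"
        using p zero by auto
    qed auto
    moreover have "D (M p) (\<lambda>w. of_bool (w = p)) = 1"
      using V p by (simp add: green)
    moreover have "lam \<le> C"
      unfolding C_def using V p by (intro less.prems(2)) auto
    ultimately show ?thesis
      using mult_right_mono[of lam C "M p p"] M_diag_nonneg[of p] V 3 ratio by simp
  next
    case 4
    have bound: "lam * contraction_value a b \<le> R a b * (real (card V) - 2)"
      if ab: "a \<in> V" "b \<in> V" "a \<noteq> b" "b \<noteq> ground" for a b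
    proof -
      define \<pi> where "\<pi> w = (if w = b then a else w)" for w
      define M' where "M' u w = M u w - (M a u - M b u) * (M a w - M b w) / R a b" for u w
      note con = contraction[OF ab, folded \<pi>_def M'_def]
      have "lam * forest_ratio (V - {b}) E (\<pi> \<circ> src) (\<pi> \<circ> tgt) c M' \<le> real (card (V - {b})) - 1"
      proof (rule less.hyps)
        show "card (V - {b}) < card V" using ab finite_V by (intro psubset_card_mono) auto
        show "green_network (V - {b}) E (\<pi> \<circ> src) (\<pi> \<circ> tgt) c ground M'"
          using con(1) by (simp add: \<pi>_def[abs_def] M'_def[abs_def])
        fix S assume S: "S \<subseteq> V - {b}" "S \<noteq> {}" "S \<noteq> V - {b}"
        \<comment> \<open>The preimage under \<open>\<pi>\<close>: every cut of the contracted
          network is a cut of the original one with the same edges.\<close>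
        define S' where "S' = {w \<in> V. \<pi> w \<in> S}"
        have "lam \<le> (\<Sum>e | e \<in> E \<and> (src e \<in> S') \<noteq> (tgt e \<in> S'). c e)"
        proof (rule less.prems(2))
          show "S' \<noteq> {}" "S' \<noteq> V" using S ab by (auto simp: S'_def \<pi>_def)
        qed (auto simp: S'_def)
        also have "{e. e \<in> E \<and> (src e \<in> S') \<noteq> (tgt e \<in> S')}
            = {e. e \<in> E \<and> ((\<pi> \<circ> src) e \<in> S) \<noteq> ((\<pi> \<circ> tgt) e \<in> S)}"
          by (auto simp: S'_def)
        finally show "lam \<le> (\<Sum>e | e \<in> E \<and> ((\<pi> \<circ> src) e \<in> S) \<noteq> ((\<pi> \<circ> tgt) e \<in> S). c e)" .
      qed
      also have "real (card (V - {b})) - 1 = real (card V) - 2"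
        using ab finite_V 4 by (simp add: card_Diff_singleton)
      finally have "R a b * (lam * forest_ratio (V - {b}) E (\<pi> \<circ> src) (\<pi> \<circ> tgt) c M')
          \<le> R a b * (real (card V) - 2)"
        using R_pos[OF ab(1-3)] by (intro mult_left_mono) auto
      moreover have "R a b * forest_ratio (V - {b}) E (\<pi> \<circ> src) (\<pi> \<circ> tgt) c M' = contraction_value a b"
        using con(2) by (simp add: \<pi>_def[abs_def] M'_def[abs_def])
      ultimately show ?thesis by (simp add: mult.left_commute)
    qed
    have edge: "lam * contraction_value (src e) (tgt e) \<le> R (src e) (tgt e) * (real (card V) - 2)"
      if e: "e \<in> E" for e
    proof -
      \<comment> \<open>Loops have contraction value 0; for any other edge an end different from
        \<open>ground\<close> is chosen as the vertex to remove.\<close>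
      consider "src e = tgt e" | "src e \<noteq> tgt e" "tgt e \<noteq> ground" | "src e \<noteq> tgt e" "src e \<noteq> ground"
        by auto
      then show ?thesis
      proof cases
        case 3
        then show ?thesis
          using bound[of "tgt e" "src e"] e
          by (simp add: contraction_value_commute[of "src e" "tgt e"] R_commute[of "src e" "tgt e"])
      qed (use bound e in auto)
    qed
    have "lam * ((real (card V) - 2) * forest_ratio V E src tgt c M)
        = (\<Sum>e\<in>E. c e * (lam * contraction_value (src e) (tgt e)))"
      unfolding contraction_identity[symmetric] sum_distrib_left by (simp add: mult.left_commute)
    also have "\<dots> \<le> (\<Sum>e\<in>E. c e * (R (src e) (tgt e) * (real (card V) - 2)))"
      by (intro sum_mono mult_left_mono edge) (auto simp: less_imp_le[OF c_pos])
    also have "\<dots> = (real (card V) - 2) * (real (card V) - 1)"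
      unfolding foster[symmetric] sum_distrib_left by (simp add: mult_ac)
    finally have "(real (card V) - 2) * (lam * forest_ratio V E src tgt c M)
        \<le> (real (card V) - 2) * (real (card V) - 1)"
      by (simp add: mult_ac)
    then show ?thesis using 4 by simp
  qed
qed

section \<open>Circuits and subdivision\<close>

lemma connected_no_crossing_arc:
  assumes "Digraph_Component.connected H" "a \<in> verts H" "b \<in> verts H" "a \<in> S"
    and "\<And>e. e \<in> arcs H \<Longrightarrow> tail H e \<in> S \<longleftrightarrow> head H e \<in> S"
  shows "b \<in> S"
proof -
  have "reachable (with_proj (mk_symmetric H)) a b"
    using assms(1-3) unfolding Digraph_Component.connected_def strongly_connected_def by simp
  then have "(a, b) \<in> (arcs_ends (with_proj (mk_symmetric H)))\<^sup>*"
    by (rule reachable_rtranclI)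
  then show ?thesis
  proof induction
    case (step u w)
    then show ?case
      using assms(5) by (auto simp: parcs_mk_symmetric)
  qed fact
qed

context fin_digraph
begin

lemma sum_divergence:
  fixes i h :: "_ \<Rightarrow> real"
  shows "(\<Sum>u\<in>verts G. h u * ((\<Sum>e\<in>out_arcs G u. i e) - (\<Sum>e\<in>in_arcs G u. i e)))
    = (\<Sum>e\<in>arcs G. (h (tail G e) - h (head G e)) * i e)"
proof -
  have "(\<Sum>u\<in>verts G. h u * (\<Sum>e\<in>out_arcs G u. i e))
      = (\<Sum>u\<in>verts G. \<Sum>e | e \<in> arcs G \<and> tail G e = u. h (tail G e) * i e)"
    unfolding sum_distrib_left out_arcs_def by (intro sum.cong refl) auto
  also have "\<dots> = (\<Sum>e\<in>arcs G. h (tail G e) * i e)"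
    by (rule sum.group) auto
  finally have out: "(\<Sum>u\<in>verts G. h u * (\<Sum>e\<in>out_arcs G u. i e)) = (\<Sum>e\<in>arcs G. h (tail G e) * i e)" .
  have "(\<Sum>u\<in>verts G. h u * (\<Sum>e\<in>in_arcs G u. i e))
      = (\<Sum>u\<in>verts G. \<Sum>e | e \<in> arcs G \<and> head G e = u. h (head G e) * i e)"
    unfolding sum_distrib_left in_arcs_def by (intro sum.cong refl) auto
  also have "\<dots> = (\<Sum>e\<in>arcs G. h (head G e) * i e)"
    by (rule sum.group) auto
  finally have inn: "(\<Sum>u\<in>verts G. h u * (\<Sum>e\<in>in_arcs G u. i e)) = (\<Sum>e\<in>arcs G. h (head G e) * i e)" .
  show ?thesis
    by (simp only: right_diff_distrib left_diff_distrib sum_subtractf out inn)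
qed

text \<open>Kirchhoff's law in weak form, by summation by parts; indicators of vertices as
  \<open>h\<close> recover the node equations. In this form the sums over a subdivided edge
  telescope.\<close>

lemma unit_current_potential_iff:
  assumes "a \<in> verts G" "b \<in> verts G"
  shows "unit_current_potential G l a b \<phi> \<longleftrightarrow>
    (\<forall>h. (\<Sum>e\<in>arcs G. (\<phi> (head G e) - \<phi> (tail G e)) * (h (head G e) - h (tail G e)) / l e) = h a - h b)"
proof -
  let ?i = "\<lambda>e. (\<phi> (tail G e) - \<phi> (head G e)) / l e"
  let ?div = "\<lambda>u. (\<Sum>e\<in>out_arcs G u. ?i e) - (\<Sum>e\<in>in_arcs G u. ?i e)"
  have *: "(\<Sum>e\<in>arcs G. (\<phi> (head G e) - \<phi> (tail G e)) * (h (head G e) - h (tail G e)) / l e)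
      = (\<Sum>u\<in>verts G. h u * ?div u)" for h
    unfolding sum_divergence[of h ?i] by (intro sum.cong refl) (simp add: algebra_simps)
  have **: "(\<Sum>u\<in>verts G. h u * ((if u = a then 1 else 0) - (if u = b then 1 else 0))) = h a - h b"
    for h :: "'a \<Rightarrow> real"
  proof -
    have "(\<Sum>u\<in>verts G. h u * ((if u = a then 1 else 0) - (if u = b then 1 else 0)))
        = (\<Sum>u\<in>verts G. (if u = a then h u else 0) - (if u = b then h u else 0))"
      by (intro sum.cong) auto
    then show ?thesis using assms by (simp add: sum_subtractf)
  qed
  show ?thesis
  proof
    assume u: "unit_current_potential G l a b \<phi>"
    show "\<forall>h. (\<Sum>e\<in>arcs G. (\<phi> (head G e) - \<phi> (tail G e)) * (h (head G e) - h (tail G e)) / l e) = h a - h b"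
    proof
      fix h
      show "(\<Sum>e\<in>arcs G. (\<phi> (head G e) - \<phi> (tail G e)) * (h (head G e) - h (tail G e)) / l e) = h a - h b"
        unfolding *[of h] **[of h, symmetric]
        using u by (intro sum.cong refl) (simp add: unit_current_potential_def)
    qed
  next
    assume h: "\<forall>h. (\<Sum>e\<in>arcs G. (\<phi> (head G e) - \<phi> (tail G e)) * (h (head G e) - h (tail G e)) / l e) = h a - h b"
    show "unit_current_potential G l a b \<phi>"
      unfolding unit_current_potential_def
    proof
      fix u assume "u \<in> verts G"
      have "(\<Sum>w\<in>verts G. of_bool (w = u) * ?div w) = (\<Sum>w\<in>verts G. if w = u then ?div w else 0)"
        by (intro sum.cong) auto
      then have "?div u = (\<Sum>w\<in>verts G. of_bool (w = u) * ?div w)"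
        using \<open>u \<in> verts G\<close> by simp
      also have "\<dots> = of_bool (a = u) - of_bool (b = u)"
        by (rule trans[OF *[of "\<lambda>w. of_bool (w = u)", symmetric] h[rule_format, of "\<lambda>w. of_bool (w = u)"]])
      finally show "?div u = (if u = a then 1 else 0) - (if u = b then 1 else 0)"
        by auto
    qed
  qed
qed

text \<open>Uniqueness is by reciprocity, so no connectedness is needed.\<close>

lemma circuit_resistance_eq:
  assumes "a \<in> verts G" "b \<in> verts G"
    and "\<And>h. (\<Sum>e\<in>arcs G. (\<phi> (head G e) - \<phi> (tail G e)) * (h (head G e) - h (tail G e)) / l e) = h a - h b"
  shows "circuit_resistance G l a b = \<phi> a - \<phi> b"
  unfolding circuit_resistance_def
proof (rule the_equality)
  show "\<exists>\<phi>'. unit_current_potential G l a b \<phi>' \<and> \<phi> a - \<phi> b = \<phi>' a - \<phi>' b"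
    using assms by (auto simp: unit_current_potential_iff)
  fix r assume "\<exists>\<phi>'. unit_current_potential G l a b \<phi>' \<and> r = \<phi>' a - \<phi>' b"
  then obtain \<phi>' where \<phi>': "unit_current_potential G l a b \<phi>'" "r = \<phi>' a - \<phi>' b" by auto
  then show "r = \<phi> a - \<phi> b"
    using assms(3)[of \<phi>'] \<phi>'(1)[unfolded unit_current_potential_iff[OF assms(1,2)], rule_format, of \<phi>]
    by (simp add: mult.commute)
qed

end

section \<open>Sums over the pieces of a subdivided edge\<close>

definition gaps :: "real set \<Rightarrow> (real \<times> real) set" where
  "gaps C = {(s, t). s \<in> C \<and> t \<in> C \<and> s < t \<and> C \<inter> {s<..<t} = {}}"

lemma finite_gaps: "finite C \<Longrightarrow> finite (gaps C)"
  by (rule finite_subset[of _ "C \<times> C"]) (auto simp: gaps_def)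

text \<open>Telescoping: a new maximum \<open>m\<close> creates exactly one new gap, from the old
  maximum to \<open>m\<close>.\<close>

lemma sum_gaps:
  fixes H :: "real \<Rightarrow> real"
  assumes "finite C" "C \<noteq> {}"
  shows "(\<Sum>(s, t)\<in>gaps C. H t - H s) = H (Max C) - H (Min C)"
  using assms
proof (induction C rule: finite_linorder_max_induct)
  case (insert m C)
  show ?case
  proof (cases "C = {}")
    case True
    have "gaps {m} = {}" by (auto simp: gaps_def)
    then show ?thesis using True by simp
  next
    case False
    let ?M = "Max C"
    have M: "?M \<in> C" "?M < m" "\<And>x. x \<in> C \<Longrightarrow> x \<le> ?M"
      using insert.hyps False by auto
    have "(s, t) \<in> gaps (insert m C) \<longleftrightarrow> (s, t) = (?M, m) \<or> (s, t) \<in> gaps C" for s t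
    proof (cases "t = m")
      case True
      have "m \<notin> C" using insert.hyps(2) by auto
      moreover have "s = ?M" if "s \<in> C" "C \<inter> {s<..<m} = {}"
        using that M by (metis IntI empty_iff greaterThanLessThan_iff order_le_less)
      moreover have "C \<inter> {?M<..<m} = {}" using M(3) by force
      ultimately show ?thesis using True M insert.hyps(2) by (auto simp: gaps_def)
    next
      case False
      then show ?thesis using insert.hyps(2) M by (auto simp: gaps_def)
    qed
    then have "gaps (insert m C) = insert (?M, m) (gaps C)" by auto
    moreover have "(?M, m) \<notin> gaps C"
      using insert.hyps by (auto simp: gaps_def)
    moreover have "Max (insert m C) = m" "Min (insert m C) = Min C"
      using Max_insert[OF insert.hyps(1) False, of m] Min_insert[OF insert.hyps(1) False, of m]
        M(2) Min_le[OF insert.hyps(1) M(1)] by linarith+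
    ultimately show ?thesis
      using insert.IH False finite_gaps[OF insert.hyps(1)] by simp
  qed
qed simp

fun interp :: "('a, 'b) pre_digraph \<Rightarrow> 'b weight_fun \<Rightarrow> ('a \<Rightarrow> real) \<Rightarrow> ('a, 'b) point \<Rightarrow> real" where
  "interp G L f (Vertex u) = f u"
| "interp G L f (Inner e t) = (1 - t / L e) * f (tail G e) + t / L e * f (head G e)"

text \<open>The Green function of a single edge with both of its ends grounded.\<close>

fun bump :: "'b weight_fun \<Rightarrow> ('a, 'b) point \<Rightarrow> ('a, 'b) point \<Rightarrow> real" where
  "bump L (Inner e s) (Inner f t) = (if e = f then min s t - s * t / L e else 0)"
| "bump L _ _ = 0"

lemma bump_commute: "bump L x y = bump L y x"
  by (cases x; cases y) (auto simp: min.commute mult.commute)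

context metrized_graph
begin

lemma interp_edge_point:
  assumes "e \<in> arcs G" "0 \<le> t" "t \<le> L e"
  shows "interp G L f (edge_point G L e t) = f (tail G e) + t / L e * (f (head G e) - f (tail G e))"
  using assms length_pos[OF assms(1)] by (auto simp: edge_point_def algebra_simps)

lemma bump_edge_point:
  assumes "e \<in> arcs G" "0 \<le> t" "t \<le> L e" "0 < r" "r < L e"
  shows "bump L (Inner e r) (edge_point G L e t) = min r t - r * t / L e"
  using assms by (auto simp: edge_point_def)

lemma bump_edge_point_other: "e \<noteq> f \<Longrightarrow> bump L (Inner f r) (edge_point G L e t) = 0"
  by (auto simp: edge_point_def)

lemma bump_Vertex [simp]: "bump L (Vertex u) z = 0" "bump L z (Vertex u) = 0"
  by (cases z; simp)+

context
  fixes S :: "('a, 'b) point set"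
  assumes finite_S: "finite S" and S_points: "S \<subseteq> points G L"
begin

lemma finite_cut_points: "finite (cut_points L S e)"
proof -
  have "finite (Inner e -` S)"
    by (rule finite_vimageI[OF finite_S]) (simp add: inj_on_def)
  then show ?thesis by (simp add: cut_points_def vimage_def)
qed

lemma cut_points_range: "e \<in> arcs G \<Longrightarrow> t \<in> cut_points L S e \<Longrightarrow> 0 \<le> t \<and> t \<le> L e"
  using S_points length_pos[of e] by (auto simp: cut_points_def points_def)

lemma sum_gaps_cut_points:
  fixes H :: "real \<Rightarrow> real"
  assumes "e \<in> arcs G"
  shows "(\<Sum>(s, t)\<in>gaps (cut_points L S e). H t - H s) = H (L e) - H 0"
proof -
  have "Max (cut_points L S e) = L e"
    by (rule Max_eqI[OF finite_cut_points]) (use cut_points_range[OF assms] in \<open>auto simp: cut_points_def\<close>)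
  moreover have "Min (cut_points L S e) = 0"
    by (rule Min_eqI[OF finite_cut_points]) (use cut_points_range[OF assms] in \<open>auto simp: cut_points_def\<close>)
  moreover have "cut_points L S e \<noteq> {}" by (auto simp: cut_points_def)
  ultimately show ?thesis using sum_gaps[OF finite_cut_points] by metis
qed

lemma arcs_subdivide: "arcs (subdivide G L S) = Sigma (arcs G) (\<lambda>e. gaps (cut_points L S e))"
  by (auto simp: subdivide_def gaps_def)

lemma sum_arcs_subdivide:
  "(\<Sum>a\<in>arcs (subdivide G L S). F a) = (\<Sum>e\<in>arcs G. \<Sum>(s, t)\<in>gaps (cut_points L S e). F (e, s, t))"
  unfolding arcs_subdivide using finite_gaps[OF finite_cut_points]
  by (subst sum.Sigma) (auto intro!: sum.cong)

lemma edge_point_in_subdivide: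
  assumes "e \<in> arcs G" "t \<in> cut_points L S e"
  shows "edge_point G L e t \<in> Vertex ` verts G \<union> S"
  using assms length_pos[OF assms(1)] by (auto simp: edge_point_def cut_points_def)

lemma fin_digraph_subdivide: "fin_digraph (subdivide G L S)"
proof unfold_locales
  show "finite (arcs (subdivide G L S))"
    unfolding arcs_subdivide using finite_gaps[OF finite_cut_points] by auto
  show "finite (verts (subdivide G L S))"
    using finite_S by (simp add: subdivide_def)
  fix a assume "a \<in> arcs (subdivide G L S)"
  then obtain e s t where a: "a = (e, s, t)" "e \<in> arcs G" "s \<in> cut_points L S e" "t \<in> cut_points L S e"
    by (auto simp: subdivide_def)
  show "tail (subdivide G L S) a \<in> verts (subdivide G L S)"
    using edge_point_in_subdivide[OF a(2,3)] by (simp add: a(1) subdivide_def)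
  show "head (subdivide G L S) a \<in> verts (subdivide G L S)"
    using edge_point_in_subdivide[OF a(2,4)] by (simp add: a(1) subdivide_def)
qed

text \<open>The reproducing property of \<open>bump\<close> on its edge. Its slope is
  \<open>1 - r / L e\<close> before \<open>r\<close> and \<open>- r / L e\<close> after it, so the
  pairing with \<open>h\<close> telescopes.\<close>

lemma sum_gaps_bump:
  fixes h :: "('a, 'b) point \<Rightarrow> real"
  assumes "e \<in> arcs G" "Inner e r \<in> S"
  shows "(\<Sum>(s, t)\<in>gaps (cut_points L S e).
      (bump L (Inner e r) (edge_point G L e t) - bump L (Inner e r) (edge_point G L e s))
      * (h (edge_point G L e t) - h (edge_point G L e s)) / (t - s))
    = h (Inner e r) - interp G L (h \<circ> Vertex) (Inner e r)"
proof -
  let ?p = "edge_point G L e"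
  have r: "0 < r" "r < L e" "r \<in> cut_points L S e"
    using assms S_points by (auto simp: points_def cut_points_def)
  have step: "(bump L (Inner e r) (?p t) - bump L (Inner e r) (?p s)) * (h (?p t) - h (?p s)) / (t - s)
      = (h (?p (min t r)) - r / L e * h (?p t)) - (h (?p (min s r)) - r / L e * h (?p s))"
    if "(s, t) \<in> gaps (cut_points L S e)" for s t
  proof -
    \<comment> \<open>As \<open>r\<close> is itself a cut point, no gap straddles it.\<close>
    have st: "s < t" "t \<le> r \<or> r \<le> s" "0 \<le> s" "s \<le> L e" "0 \<le> t" "t \<le> L e"
      using that r(3) cut_points_range[OF assms(1)] by (force simp: gaps_def)+
    have "(min r t - r * t / L e) - (min r s - r * s / L e)
        = (t - s) * (of_bool (t \<le> r) - r / L e)"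
      using st by (auto simp: algebra_simps diff_divide_distrib)
    then have "bump L (Inner e r) (?p t) - bump L (Inner e r) (?p s)
        = (t - s) * (of_bool (t \<le> r) - r / L e)"
      using st r assms by (simp add: bump_edge_point)
    moreover have "(t - s) * k * X / (t - s) = k * X" for k X
      using st by simp
    ultimately have "(bump L (Inner e r) (?p t) - bump L (Inner e r) (?p s)) * (h (?p t) - h (?p s)) / (t - s)
        = (of_bool (t \<le> r) - r / L e) * (h (?p t) - h (?p s))"
      by simp
    also have "\<dots> = (h (?p (min t r)) - r / L e * h (?p t)) - (h (?p (min s r)) - r / L e * h (?p s))"
      using st by (auto simp: algebra_simps min_def)
    finally show ?thesis .
  qed
  have "(\<Sum>(s, t)\<in>gaps (cut_points L S e).
      (bump L (Inner e r) (?p t) - bump L (Inner e r) (?p s)) * (h (?p t) - h (?p s)) / (t - s))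
      = (\<Sum>(s, t)\<in>gaps (cut_points L S e).
        (h (?p (min t r)) - r / L e * h (?p t)) - (h (?p (min s r)) - r / L e * h (?p s)))"
    by (intro sum.cong refl) (auto simp: step)
  also have "\<dots> = (h (?p (min (L e) r)) - r / L e * h (?p (L e))) - (h (?p (min 0 r)) - r / L e * h (?p 0))"
    by (rule sum_gaps_cut_points[OF assms(1)])
  also have "\<dots> = h (Inner e r) - interp G L (h \<circ> Vertex) (Inner e r)"
    using r by (simp add: edge_point_def algebra_simps)
  finally show ?thesis .
qed

lemma subdivide_bump:
  fixes h :: "('a, 'b) point \<Rightarrow> real"
  assumes "x \<in> S"
  shows "(\<Sum>e\<in>arcs G. \<Sum>(s, t)\<in>gaps (cut_points L S e).
      (bump L x (edge_point G L e t) - bump L x (edge_point G L e s))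
      * (h (edge_point G L e t) - h (edge_point G L e s)) / (t - s))
    = h x - interp G L (h \<circ> Vertex) x"
proof (cases x)
  case (Vertex u)
  then show ?thesis by (simp add: case_prod_unfold)
next
  case (Inner f r)
  then have f: "f \<in> arcs G" "Inner f r \<in> S"
    using assms S_points by (auto simp: points_def)
  have "(\<Sum>(s, t)\<in>gaps (cut_points L S e).
      (bump L x (edge_point G L e t) - bump L x (edge_point G L e s))
      * (h (edge_point G L e t) - h (edge_point G L e s)) / (t - s))
      = (if e = f then h x - interp G L (h \<circ> Vertex) x else 0)" for e
    using sum_gaps_bump[OF f] by (auto simp: Inner bump_edge_point_other case_prod_unfold simp del: interp.simps)
  then show ?thesis using f by simp
qed

text \<open>An interpolated function has constant slope along each edge, so its pairing with any
  \<open>h\<close> telescopes and sees \<open>h\<close> only at the vertices.\<close>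

lemma subdivide_interp:
  fixes h :: "('a, 'b) point \<Rightarrow> real"
  shows "(\<Sum>e\<in>arcs G. \<Sum>(s, t)\<in>gaps (cut_points L S e).
      (interp G L \<psi> (edge_point G L e t) - interp G L \<psi> (edge_point G L e s))
      * (h (edge_point G L e t) - h (edge_point G L e s)) / (t - s))
    = (\<Sum>e\<in>arcs G. 1 / L e * (\<psi> (head G e) - \<psi> (tail G e)) * (h (Vertex (head G e)) - h (Vertex (tail G e))))"
proof (rule sum.cong)
  fix e assume e: "e \<in> arcs G"
  let ?p = "edge_point G L e" and ?m = "(\<psi> (head G e) - \<psi> (tail G e)) / L e"
  have "(\<Sum>(s, t)\<in>gaps (cut_points L S e).
      (interp G L \<psi> (?p t) - interp G L \<psi> (?p s)) * (h (?p t) - h (?p s)) / (t - s))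
      = (\<Sum>(s, t)\<in>gaps (cut_points L S e). ?m * h (?p t) - ?m * h (?p s))"
  proof (intro sum.cong refl, clarify)
    fix s t assume "(s, t) \<in> gaps (cut_points L S e)"
    then have st: "s < t" "0 \<le> s" "s \<le> L e" "0 \<le> t" "t \<le> L e"
      using cut_points_range[OF e] by (auto simp: gaps_def)
    then have diff: "interp G L \<psi> (?p t) - interp G L \<psi> (?p s) = ?m * (t - s)"
      using e by (simp add: interp_edge_point algebra_simps diff_divide_distrib)
    have "k * (t - s) * X / (t - s) = k * X" for k X
      using st by simp
    then have "(interp G L \<psi> (?p t) - interp G L \<psi> (?p s)) * (h (?p t) - h (?p s)) / (t - s)
        = ?m * (h (?p t) - h (?p s))"
      unfolding diff .
    then show "(interp G L \<psi> (?p t) - interp G L \<psi> (?p s)) * (h (?p t) - h (?p s)) / (t - s)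
        = ?m * h (?p t) - ?m * h (?p s)"
      by (simp only: right_diff_distrib)
  qed
  also have "\<dots> = ?m * h (?p (L e)) - ?m * h (?p 0)"
    by (rule sum_gaps_cut_points[OF e])
  also have "\<dots> = ?m * (h (?p (L e)) - h (?p 0))"
    by (rule right_diff_distrib[symmetric])
  finally show "(\<Sum>(s, t)\<in>gaps (cut_points L S e).
      (interp G L \<psi> (?p t) - interp G L \<psi> (?p s)) * (h (?p t) - h (?p s)) / (t - s))
      = 1 / L e * (\<psi> (head G e) - \<psi> (tail G e)) * (h (Vertex (head G e)) - h (Vertex (tail G e)))"
    using length_pos[OF e] by (simp add: edge_point_def)
qed simp

end

end

section \<open>Existence of the Green function and resistance between arbitrary points\<close>

locale metrized_green = metrized_graph G L +
    green_network "verts G" "arcs G" "tail G" "head G" "\<lambda>e. 1 / L e" ground M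
  for G :: "('a, 'b) pre_digraph" and L :: "'b weight_fun" and ground :: 'a and M

context metrized_graph
begin

lemma network: "network (verts G) (arcs G) (tail G) (head G) (\<lambda>e. 1 / L e)"
  by unfold_locales (auto simp: length_pos)

text \<open>Riesz representation of \<open>f u - f ground\<close>: this functional vanishes where
  all edge differences do, because by connectedness such an \<open>f\<close> is constant on the
  vertices.\<close>

lemma obtains_green:
  obtains ground M where "metrized_green G L ground M"
proof -
  interpret N: network "verts G" "arcs G" "tail G" "head G" "\<lambda>e. 1 / L e" by (rule network)
  obtain ground where ground: "ground \<in> verts G"
    using connected_graph by (auto simp: Digraph_Component.connected_def strongly_connected_def)
  have "\<exists>x. \<forall>f. f u - f ground = N.D x f" if u: "u \<in> verts G" for u
  proof -
    obtain x where "\<And>f. f u - f ground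
        = (\<Sum>e\<in>arcs G. 1 / L e * (x (head G e) - x (tail G e)) * (f (head G e) - f (tail G e)))"
    proof (rule riesz_semidefinite[of "arcs G" "\<lambda>e f. f (head G e) - f (tail G e)" "\<lambda>e. 1 / L e"
          "\<lambda>f. f u - f ground"])
      fix f :: "'a \<Rightarrow> real" assume f: "\<And>e. e \<in> arcs G \<Longrightarrow> f (head G e) - f (tail G e) = 0"
      have "ground \<in> {w. f w = f u}"
        by (rule connected_no_crossing_arc[OF connected_graph u ground]) (use f in auto)
      then show "f u - f ground = 0" by simp
    qed (auto simp: length_pos linear_functional_eval_diff)
    then show ?thesis unfolding N.D_def by blast
  qed
  then obtain X where X: "\<And>u f. u \<in> verts G \<Longrightarrow> f u - f ground = N.D (X u) f" by metis
  \<comment> \<open>Subtracting a constant from \<open>X u\<close> leaves \<open>N.D\<close>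
    unchanged and makes the value at \<open>ground\<close> zero.\<close>
  have "metrized_green G L ground (\<lambda>u w. X u w - X u ground)"
  proof unfold_locales
    fix u f assume u: "u \<in> verts G"
    have "N.D (\<lambda>w. X u w - X u ground) f = N.D (X u) f" unfolding N.D_def by simp
    then show "N.D (\<lambda>w. X u w - X u ground) f = f u - f ground" using X[OF u] by simp
  qed (auto simp: ground)
  then show thesis by (rule that)
qed

end

context metrized_green
begin

text \<open>Current entering inside an edge is replaced by currents at its two ends in the
  proportion \<open>1 - t / L e\<close> to \<open>t / L e\<close>. The part of the true potential
  that this misses is \<open>bump\<close>.\<close>

definition potential :: "('a, 'b) point \<Rightarrow> 'a \<Rightarrow> real" where
  "potential x w = interp G L (\<lambda>u. M u w) x"

lemma potential_Vertex [simp]: "potential (Vertex u) = M u"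
  by (simp add: potential_def fun_eq_iff)

lemma potential_Inner:
  "potential (Inner e t) = (\<lambda>w. (1 - t / L e) * M (tail G e) w + t / L e * M (head G e) w)"
  by (simp add: potential_def fun_eq_iff)

lemma D_potential:
  assumes "x \<in> points G L"
  shows "D (potential x) f = interp G L f x - f ground"
proof (cases x)
  case (Vertex u)
  then show ?thesis using assms by (auto simp: points_def green)
next
  case (Inner e t)
  then have e: "e \<in> arcs G" using assms by (auto simp: points_def)
  show ?thesis
    unfolding Inner potential_Inner D_add_left D_scale_left
    using e by (simp add: green algebra_simps)
qed

lemma potential_ground: "x \<in> points G L \<Longrightarrow> potential x ground = 0"
  by (cases x) (auto simp: potential_Inner points_def green_root)

definition greens :: "('a, 'b) point \<Rightarrow> ('a, 'b) point \<Rightarrow> real" where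
  "greens x y = interp G L (potential x) y"

lemma D_potential_potential:
  assumes "x \<in> points G L" "y \<in> points G L"
  shows "D (potential x) (potential y) = greens y x"
  using assms by (simp add: D_potential potential_ground greens_def)

lemma greens_commute:
  "x \<in> points G L \<Longrightarrow> y \<in> points G L \<Longrightarrow> greens x y = greens y x"
  using D_potential_potential[of x y] D_potential_potential[of y x] D_commute by simp

lemma interp_diff: "interp G L (\<lambda>w. f w - g w) z = interp G L f z - interp G L g z"
  by (cases z) (auto simp: algebra_simps)

text \<open>\<open>greens + bump\<close> is the Green function on all points, and
  \<open>\<phi>\<close> is the difference of its potentials from \<open>x\<close> and from
  \<open>y\<close>. Paired with \<open>h\<close>, the first part yields the interpolated values of
  \<open>h\<close> and the second the deviations from them, which add up to
  \<open>h x - h y\<close>.\<close>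

lemma resistance_eq:
  assumes x: "x \<in> points G L" and y: "y \<in> points G L"
  shows "resistance G L x y
    = greens x x - 2 * greens x y + greens y y + bump L x x - 2 * bump L x y + bump L y y"
proof -
  have S: "finite {x, y}" "{x, y} \<subseteq> points G L" using x y by auto
  interpret S: fin_digraph "subdivide G L {x, y}" by (rule fin_digraph_subdivide[OF S])
  define \<psi> where "\<psi> w = potential x w - potential y w" for w
  define \<phi> where "\<phi> z = interp G L \<psi> z + bump L x z - bump L y z" for z
  have "circuit_resistance (subdivide G L {x, y}) (\<lambda>(e, s, t). t - s) x y = \<phi> x - \<phi> y"
  proof (rule S.circuit_resistance_eq)
    fix h :: "('a, 'b) point \<Rightarrow> real"
    let ?p = "edge_point G L" and ?C = "cut_points L {x, y}"
    have "(\<Sum>a\<in>arcs (subdivide G L {x, y}).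
          (\<phi> (head (subdivide G L {x, y}) a) - \<phi> (tail (subdivide G L {x, y}) a))
          * (h (head (subdivide G L {x, y}) a) - h (tail (subdivide G L {x, y}) a))
          / (case a of (e, s, t) \<Rightarrow> t - s))
        = (\<Sum>e\<in>arcs G. \<Sum>(s, t)\<in>gaps (?C e).
            (\<phi> (?p e t) - \<phi> (?p e s)) * (h (?p e t) - h (?p e s)) / (t - s))"
      unfolding sum_arcs_subdivide[OF S] by (simp add: subdivide_def)
    also have "\<dots> = (\<Sum>e\<in>arcs G.
            (\<Sum>(s, t)\<in>gaps (?C e).
              (interp G L \<psi> (?p e t) - interp G L \<psi> (?p e s)) * (h (?p e t) - h (?p e s)) / (t - s))
            + (\<Sum>(s, t)\<in>gaps (?C e).
              (bump L x (?p e t) - bump L x (?p e s)) * (h (?p e t) - h (?p e s)) / (t - s))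
            - (\<Sum>(s, t)\<in>gaps (?C e).
              (bump L y (?p e t) - bump L y (?p e s)) * (h (?p e t) - h (?p e s)) / (t - s)))"
      unfolding sum.distrib[symmetric] sum_subtractf[symmetric] case_prod_unfold
        add_divide_distrib[symmetric] diff_divide_distrib[symmetric]
      by (intro sum.cong refl arg_cong2[of _ _ _ _ "(/)"]) (simp add: \<phi>_def algebra_simps)
    also have "\<dots> = D \<psi> (h \<circ> Vertex)
        + (h x - interp G L (h \<circ> Vertex) x) - (h y - interp G L (h \<circ> Vertex) y)"
      unfolding sum.distrib sum_subtractf subdivide_interp[OF S]
        subdivide_bump[OF S, of x, OF insertI1] subdivide_bump[OF S, of y, OF insertI2, OF insertI1]
      by (simp add: D_def)
    also have "\<dots> = h x - h y"
      using x y unfolding \<psi>_def D_diff_left by (simp add: D_potential)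
    finally show "(\<Sum>a\<in>arcs (subdivide G L {x, y}).
          (\<phi> (head (subdivide G L {x, y}) a) - \<phi> (tail (subdivide G L {x, y}) a))
          * (h (head (subdivide G L {x, y}) a) - h (tail (subdivide G L {x, y}) a))
          / (case a of (e, s, t) \<Rightarrow> t - s)) = h x - h y" .
  qed (simp_all add: subdivide_def)
  also have "\<phi> x - \<phi> y
      = greens x x - 2 * greens x y + greens y y + bump L x x - 2 * bump L x y + bump L y y"
    using greens_commute[OF x y] bump_commute[of L x y]
    by (simp add: \<phi>_def \<psi>_def[abs_def] interp_diff greens_def)
  finally show ?thesis unfolding resistance_def .
qed

end

section \<open>The tau constant in terms of the Green function\<close>

lemma has_integral_affine_square:
  fixes A w l a b :: real
  assumes "a \<le> b" "l \<noteq> 0"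
  defines "F \<equiv> \<lambda>s. A\<^sup>2 * s + 2 * A * w * (s - s\<^sup>2 / l) + w\<^sup>2 * (s - 2 * s\<^sup>2 / l + 4 * s ^ 3 / (3 * l\<^sup>2))"
  shows "((\<lambda>s. (A + w * (1 - 2 * s / l))\<^sup>2) has_integral F b - F a) {a..b}"
proof (rule fundamental_theorem_of_calculus[OF assms(1)])
  fix s
  have "(F has_real_derivative (A + w * (1 - 2 * s / l))\<^sup>2) (at s within {a..b})"
    unfolding F_def using assms(2)
    by (auto intro!: derivative_eq_intros simp: field_simps power2_eq_square power3_eq_cube)
  then show "(F has_vector_derivative (A + w * (1 - 2 * s / l))\<^sup>2) (at s within {a..b})"
    by (simp add: has_real_derivative_iff_has_vector_derivative)
qed

text \<open>\<open>\<delta>\<close> is the mean slope, \<open>w * (1 - 2 * s / l)\<close> the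
  zero-mean part due to curvature, and \<open>\<kappa>\<close> switches on a base point on the edge
  at \<open>t\<close>, where the slope jumps by \<open>2 * \<kappa>\<close>. The integral is
  therefore split at \<open>t\<close>.\<close>

lemma integral_deriv_square:
  fixes f :: "real \<Rightarrow> real"
  assumes l: "0 < l" and t: "0 \<le> t" "t \<le> l" and \<kappa>: "\<kappa> = 0 \<or> \<kappa> = (1::real)"
    and f: "\<And>s. 0 < s \<Longrightarrow> s < l \<Longrightarrow>
      f s = \<alpha> + (\<delta> + w) * s - w * s\<^sup>2 / l - 2 * \<kappa> * (min s t - s * t / l)"
  shows "integral {0..l} (\<lambda>s. (deriv f s)\<^sup>2)
    = l * \<delta>\<^sup>2 + l * w\<^sup>2 / 3 + 4 * (1 - w) * (\<kappa> * (t * (1 - t / l)))"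
proof -
  define A where "A = \<delta> - 2 * \<kappa> * (1 - t / l)"
  define B where "B = \<delta> + 2 * \<kappa> * (t / l)"
  have d1: "deriv f s = A + w * (1 - 2 * s / l)" if s: "0 < s" "s < t" for s
  proof (rule DERIV_imp_deriv, rule has_field_derivative_transform_within_open)
    show "((\<lambda>s. \<alpha> + (\<delta> + w) * s - w * s\<^sup>2 / l - 2 * \<kappa> * (s - s * t / l))
        has_real_derivative A + w * (1 - 2 * s / l)) (at s)"
      using l by (auto intro!: derivative_eq_intros simp: A_def field_simps)
    show "\<alpha> + (\<delta> + w) * x - w * x\<^sup>2 / l - 2 * \<kappa> * (x - x * t / l) = f x"
      if "x \<in> {0<..<t}" for x using that t by (simp add: f)
  qed (use s in auto)
  have d2: "deriv f s = B + w * (1 - 2 * s / l)" if s: "t < s" "s < l" for s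
  proof (rule DERIV_imp_deriv, rule has_field_derivative_transform_within_open)
    show "((\<lambda>s. \<alpha> + (\<delta> + w) * s - w * s\<^sup>2 / l - 2 * \<kappa> * (t - s * t / l))
        has_real_derivative B + w * (1 - 2 * s / l)) (at s)"
      using l by (auto intro!: derivative_eq_intros simp: B_def field_simps)
    show "\<alpha> + (\<delta> + w) * x - w * x\<^sup>2 / l - 2 * \<kappa> * (t - x * t / l) = f x"
      if "x \<in> {t<..<l}" for x using that t by (simp add: f)
  qed (use s in auto)
  let ?F = "\<lambda>A s. A\<^sup>2 * s + 2 * A * w * (s - s\<^sup>2 / l) + w\<^sup>2 * (s - 2 * s\<^sup>2 / l + 4 * s ^ 3 / (3 * l\<^sup>2))"
  \<comment> \<open>The derivative is known only in the open interval; the two end points are a null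
    set.\<close>
  have "((\<lambda>s. (deriv f s)\<^sup>2) has_integral ?F A t - ?F A 0) {0..t}"
    by (rule has_integral_spike_finite[of "{0, t}", OF _ _ has_integral_affine_square])
      (use t l d1 in auto)
  moreover have "((\<lambda>s. (deriv f s)\<^sup>2) has_integral ?F B l - ?F B t) {t..l}"
    by (rule has_integral_spike_finite[of "{t, l}", OF _ _ has_integral_affine_square])
      (use t l d2 in auto)
  ultimately have "((\<lambda>s. (deriv f s)\<^sup>2) has_integral (?F A t - ?F A 0) + (?F B l - ?F B t)) {0..l}"
    using t by (intro has_integral_combine)
  then have "integral {0..l} (\<lambda>s. (deriv f s)\<^sup>2) = (?F A t - ?F A 0) + (?F B l - ?F B t)"
    by (rule integral_unique)
  also have "\<dots> = A\<^sup>2 * t + B\<^sup>2 * (l - t) + 2 * w * (A - B) * (t - t\<^sup>2 / l) + w\<^sup>2 * l / 3"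
    using l by (simp add: field_simps power2_eq_square power3_eq_cube)
  also have "\<dots> = l * \<delta>\<^sup>2 + l * w\<^sup>2 / 3 + 4 * (1 - w) * (\<kappa> * (t * (1 - t / l)))"
  proof -
    have "A - B = - 2 * \<kappa>" by (simp add: A_def B_def algebra_simps)
    moreover have "A\<^sup>2 * t + B\<^sup>2 * (l - t) = l * \<delta>\<^sup>2 + 4 * \<kappa>\<^sup>2 * (t * (1 - t / l))"
      using l by (simp add: A_def B_def field_simps power2_eq_square)
    moreover have "t - t\<^sup>2 / l = t * (1 - t / l)"
      by (simp add: power2_eq_square algebra_simps)
    ultimately have "A\<^sup>2 * t + B\<^sup>2 * (l - t) + 2 * w * (A - B) * (t - t\<^sup>2 / l) + w\<^sup>2 * l / 3
        = l * \<delta>\<^sup>2 + 4 * \<kappa>\<^sup>2 * (t * (1 - t / l)) + 2 * w * (- 2 * \<kappa>) * (t * (1 - t / l)) + w\<^sup>2 * l / 3"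
      by (simp only:)
    moreover have "\<kappa>\<^sup>2 = \<kappa>" using \<kappa> by auto
    ultimately show ?thesis by (simp add: algebra_simps)
  qed
  finally show ?thesis .
qed

text \<open>The diagonal value of \<open>bump\<close> at a point, attributed to the edge that
  contains it.\<close>

fun edge_offset :: "'b weight_fun \<Rightarrow> 'b \<Rightarrow> ('a, 'b) point \<Rightarrow> real" where
  "edge_offset L e (Vertex u) = 0"
| "edge_offset L e (Inner f t) = (if f = e then t * (1 - t / L e) else 0)"

context metrized_green
begin

text \<open>In the position \<open>s\<close>, \<open>greens\<close> on the diagonal has quadratic
  coefficient \<open>R / L^2\<close> and \<open>bump\<close> has \<open>- 1 / L\<close>; together
  they give the curvature \<open>w = 1 - R / L\<close>.\<close>

lemma integral_edge:
  assumes e: "e \<in> arcs G" and y: "y \<in> points G L"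
  defines "K \<equiv> \<lambda>u. M u u - 2 * potential y u"
  shows "integral {0..L e} (\<lambda>t. (deriv (\<lambda>s. resistance G L (edge_point G L e s) y) t)\<^sup>2)
    = (K (head G e) - K (tail G e))\<^sup>2 / L e + L e * (1 - R (tail G e) (head G e) / L e)\<^sup>2 / 3
      + 4 * (R (tail G e) (head G e) / L e) * edge_offset L e y"
proof -
  define l where "l = L e"
  define p where "p = tail G e"
  define q where "q = head G e"
  have l: "0 < l" using e length_pos by (simp add: l_def)
  have pq: "p \<in> verts G" "q \<in> verts G" using e by (auto simp: p_def q_def)
  define \<delta> where "\<delta> = (K q - K p) / l"
  define w where "w = 1 - R p q / l"
  \<comment> \<open>\<open>\<kappa> = 1\<close> when \<open>y\<close> is interior to
    \<open>e\<close>; otherwise \<open>\<kappa> = 0\<close> with the dummy position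
    \<open>t = 0\<close>.\<close>
  obtain \<kappa> t where \<kappa>t: "0 \<le> t" "t \<le> l" "\<kappa> = 0 \<or> \<kappa> = (1::real)"
    "\<And>s. 0 < s \<Longrightarrow> s < l \<Longrightarrow> bump L (Inner e s) y = \<kappa> * (min s t - s * t / l)"
    "edge_offset L e y = \<kappa> * (t * (1 - t / l))"
  proof (cases "\<exists>t. y = Inner e t")
    case True
    then obtain t where "y = Inner e t" by auto
    then show thesis using y by (intro that[of t 1]) (auto simp: l_def points_def)
  next
    case False
    then have "bump L (Inner e s) y = 0" "edge_offset L e y = 0" for s
      by (cases y; auto)+
    then show thesis using l by (intro that[of 0 0]) auto
  qed
  have res: "resistance G L (edge_point G L e s) y
      = (M p p + greens y y + bump L y y - 2 * potential y p) + (\<delta> + w) * s - w * s\<^sup>2 / l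
        - 2 * \<kappa> * (min s t - s * t / l)"
    if s: "0 < s" "s < l" for s
  proof -
    have x: "edge_point G L e s = Inner e s" "Inner e s \<in> points G L"
      using s e by (auto simp: edge_point_def points_def l_def)
    have gy: "greens (Inner e s) y = (1 - s / l) * potential y p + s / l * potential y q"
      unfolding greens_commute[OF x(2) y] by (simp add: greens_def l_def p_def q_def)
    have gs: "greens (Inner e s) (Inner e s)
        = (1 - s / l) * ((1 - s / l) * M p p + s / l * M p q)
          + s / l * ((1 - s / l) * M p q + s / l * M q q)"
      using M_commute[OF pq] by (simp add: greens_def potential_Inner l_def p_def q_def)
    show ?thesis
      unfolding x(1) resistance_eq[OF x(2) y] \<kappa>t(4)[OF s] gy gs
      using l by (simp add: \<delta>_def w_def K_def R_def l_def[symmetric] field_simps power2_eq_square)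
  qed
  have "integral {0..l} (\<lambda>t. (deriv (\<lambda>s. resistance G L (edge_point G L e s) y) t)\<^sup>2)
      = l * \<delta>\<^sup>2 + l * w\<^sup>2 / 3 + 4 * (1 - w) * (\<kappa> * (t * (1 - t / l)))"
    by (rule integral_deriv_square[OF l \<kappa>t(1-3) res])
  then show ?thesis
    using l unfolding \<kappa>t(5)
    by (simp add: \<delta>_def w_def l_def p_def q_def power_divide power2_eq_square)
qed

text \<open>Only the edge through \<open>y\<close> contributes. Along it the diagonal of
  \<open>greens\<close> is a parabola with leading coefficient \<open>R / L^2\<close>, and the sum
  is its distance below the chord.\<close>

lemma sum_edge_offset:
  assumes y: "y \<in> points G L"
  shows "(\<Sum>e\<in>arcs G. R (tail G e) (head G e) / L e * edge_offset L e y)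
    = interp G L (\<lambda>u. M u u) y - greens y y"
proof (cases y)
  case (Vertex u)
  then show ?thesis by (simp add: greens_def)
next
  case (Inner f t)
  then have f: "f \<in> arcs G" using y by (auto simp: points_def)
  have "(\<Sum>e\<in>arcs G. R (tail G e) (head G e) / L e * edge_offset L e y)
      = (\<Sum>e\<in>arcs G. if f = e then R (tail G f) (head G f) / L f * (t * (1 - t / L f)) else 0)"
    by (intro sum.cong) (auto simp: Inner)
  also have "\<dots> = R (tail G f) (head G f) / L f * (t * (1 - t / L f))"
    using f by simp
  also have "\<dots> = interp G L (\<lambda>u. M u u) y - greens y y"
    using length_pos[OF f] M_commute[of "head G f" "tail G f"] f
    by (simp add: Inner greens_def potential_Inner R_def field_simps)
  finally show ?thesis .
qed

text \<open>Summing the edge integrals, the contributions of \<open>y\<close> cancel.\<close>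

lemma tau_eq:
  assumes y: "y \<in> points G L"
  shows "tau G L y = 1 / 4 * D (\<lambda>u. M u u) (\<lambda>u. M u u)
    + 1 / 12 * (\<Sum>e\<in>arcs G. L e * (1 - R (tail G e) (head G e) / L e)\<^sup>2)"
proof -
  let ?K = "\<lambda>u. M u u" and ?m = "potential y"
  have D_square: "D f f = (\<Sum>e\<in>arcs G. (f (head G e) - f (tail G e))\<^sup>2 / L e)" for f
    unfolding D_def by (simp add: power2_eq_square)
  have "(\<Sum>e\<in>arcs G. integral {0..L e} (\<lambda>t. (deriv (\<lambda>s. resistance G L (edge_point G L e s) y) t)\<^sup>2))
      = D (\<lambda>u. ?K u - 2 * ?m u) (\<lambda>u. ?K u - 2 * ?m u)
        + (\<Sum>e\<in>arcs G. L e * (1 - R (tail G e) (head G e) / L e)\<^sup>2) / 3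
        + 4 * (\<Sum>e\<in>arcs G. R (tail G e) (head G e) / L e * edge_offset L e y)"
    unfolding D_square sum_divide_distrib sum_distrib_left sum.distrib[symmetric]
    by (intro sum.cong refl) (simp add: integral_edge y)
  moreover have "D (\<lambda>u. ?K u - 2 * ?m u) (\<lambda>u. ?K u - 2 * ?m u)
      = D ?K ?K - 4 * interp G L ?K y + 4 * greens y y"
    using y green_root[OF root_in]
    by (simp add: D_linear D_commute[of ?K ?m] D_potential potential_ground greens_def)
  ultimately show ?thesis
    unfolding tau_def sum_edge_offset[OF y] by (simp add: algebra_simps)
qed

end

section \<open>Edge connectivity and regular graphs\<close>

context metrized_graph
begin

lemma not_connected_del_cut:
  assumes "S \<subseteq> verts G" "S \<noteq> {}" "S \<noteq> verts G"
  shows "\<not> Digraph_Component.connected (del_edges G {e \<in> arcs G. (tail G e \<in> S) \<noteq> (head G e \<in> S)})"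
    (is "\<not> Digraph_Component.connected ?H")
proof
  assume H: "Digraph_Component.connected ?H"
  obtain a b where ab: "a \<in> S" "b \<in> verts G" "b \<notin> S" using assms by auto
  have "b \<in> S"
    by (rule connected_no_crossing_arc[OF H]) (use ab assms in \<open>auto simp: del_edges_def\<close>)
  then show False using ab by simp
qed

lemma card_cut_mem:
  assumes "S \<subseteq> verts G" "S \<noteq> {}" "S \<noteq> verts G"
  shows "card {e \<in> arcs G. (tail G e \<in> S) \<noteq> (head G e \<in> S)}
    \<in> {card F |F. F \<subseteq> arcs G \<and> \<not> Digraph_Component.connected (del_edges G F)}"
  by (intro CollectI exI conjI, rule refl)
    (simp_all only: not_connected_del_cut[OF assms] Collect_restrict not_False_eq_True)

lemma edge_connectivity_le_cut:
  assumes "S \<subseteq> verts G" "S \<noteq> {}" "S \<noteq> verts G"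
  shows "edge_connectivity G \<le> card {e \<in> arcs G. (tail G e \<in> S) \<noteq> (head G e \<in> S)}"
  unfolding edge_connectivity_def
  by (rule cInf_lower[OF card_cut_mem[OF assms]]) simp

lemma edge_connectivity_ge_2:
  assumes "bridgeless G" "2 \<le> card (verts G)"
  shows "2 \<le> edge_connectivity G"
proof -
  let ?K = "{card F |F. F \<subseteq> arcs G \<and> \<not> Digraph_Component.connected (del_edges G F)}"
  obtain u w where "u \<in> verts G" "w \<in> verts G" "u \<noteq> w"
    using assms(2) by (metis card_2_iff' card_le_Suc0_iff_eq finite_verts not_less_eq_eq numeral_2_eq_2)
  then have "card {e \<in> arcs G. (tail G e \<in> {u}) \<noteq> (head G e \<in> {u})} \<in> ?K"
    by (intro card_cut_mem) auto
  \<comment> \<open>A nonempty set of naturals attains its infimum, which excludes the default value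
    0.\<close>
  then have "?K \<noteq> {}" by (metis empty_iff)
  then have "edge_connectivity G \<in> ?K"
    unfolding edge_connectivity_def by (rule Inf_nat_def1)
  then obtain F where F: "edge_connectivity G = card F" "F \<subseteq> arcs G"
      "\<not> Digraph_Component.connected (del_edges G F)" by auto
  have "finite F" using F(2) finite_arcs by (rule finite_subset)
  have "card F \<noteq> 0"
    using F(3) connected_graph \<open>finite F\<close> by (auto simp: del_edges_def)
  moreover have "card F \<noteq> 1"
  proof
    assume "card F = 1"
    then obtain e where "F = {e}" by (auto simp: card_1_singleton_iff)
    moreover have "del_edges G {e} = del_arc e"
      by (rule pre_digraph.equality) (simp_all add: del_edges_def)
    ultimately show False
      using F(2,3) assms(1) by (simp add: bridgeless_def)
  qed
  ultimately show ?thesis using F(1) by linarith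
qed

text \<open>The edges at \<open>u\<close> other than loops form a cut; loops only increase the
  valence.\<close>

lemma edge_connectivity_le_valence:
  assumes "u \<in> verts G" "2 \<le> card (verts G)"
  shows "edge_connectivity G \<le> valence G (Vertex u)"
proof -
  have "{u} \<noteq> verts G" using assms(2) by (cases "verts G = {u}") auto
  then have "edge_connectivity G \<le> card {e \<in> arcs G. (tail G e \<in> {u}) \<noteq> (head G e \<in> {u})}"
    using assms(1) by (intro edge_connectivity_le_cut) auto
  also have "\<dots> \<le> card (out_arcs G u \<union> in_arcs G u)"
    by (intro card_mono) auto
  also have "\<dots> \<le> valence G (Vertex u)"
    by (simp add: out_degree_def in_degree_def card_Un_le)
  finally show ?thesis .
qed

lemma sum_valence: "(\<Sum>u\<in>verts G. valence G (Vertex u)) = 2 * card (arcs G)"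
proof -
  have "(\<Sum>u\<in>verts G. \<Sum>e | e \<in> arcs G \<and> tail G e = u. 1) = (\<Sum>e\<in>arcs G. 1::nat)"
    by (rule sum.group) auto
  moreover have "(\<Sum>u\<in>verts G. \<Sum>e | e \<in> arcs G \<and> head G e = u. 1) = (\<Sum>e\<in>arcs G. 1::nat)"
    by (rule sum.group) auto
  ultimately show ?thesis
    by (simp add: out_degree_def in_degree_def out_arcs_def in_arcs_def sum.distrib)
qed

text \<open>A vertex of \<open>G\<close> outside the vertex set that witnesses regularity has valence \<open>2\<close>; when there
  are at least two vertices, \<open>n = \<Lambda>\<close> is then squeezed between \<open>2\<close> and \<open>2\<close>.\<close>

lemma regular_valence:
  assumes "regular_graph n G L" "edge_connectivity G = n" "bridgeless G" "u \<in> verts G"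
  shows "valence G (Vertex u) = n"
proof (rule ccontr)
  assume neq: "valence G (Vertex u) \<noteq> n"
  obtain W where W: "W \<noteq> {}" "W \<subseteq> points G L" "{x \<in> points G L. valence G x \<noteq> 2} \<subseteq> W"
      "\<forall>x\<in>W. valence G x = n"
    using assms(1) unfolding regular_graph_def is_vertex_set_def by auto
  have "Vertex u \<in> points G L" using assms(4) by (auto simp: points_def)
  then have val: "valence G (Vertex u) = 2" using W(3,4) neq by blast
  then have n2: "n \<noteq> 2" using neq by simp
  show False
  proof (cases "2 \<le> card (verts G)")
    case True
    then show False
      using edge_connectivity_ge_2[OF assms(3)] edge_connectivity_le_valence[OF assms(4)]
        assms(2) val n2 by simp
  next
    case False
    then have V: "verts G = {u}"
      using assms(4) by (metis One_nat_def card_1_singleton_iff card_gt_0_iff empty_iff finite_verts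
          less_2_cases not_le not_less_zero singletonD)
    \<comment> \<open>With \<open>u\<close> as the only vertex, every point has valence 2, which
      forces \<open>n = 2\<close>.\<close>
    obtain x where x: "x \<in> W" using W(1) by auto
    then have "valence G x = 2"
      using W(2) val V by (cases x) (auto simp: points_def)
    then show False using x W(4) n2 by simp
  qed
qed

lemma regular_card_arcs:
  assumes "regular_graph n G L" "edge_connectivity G = n" "bridgeless G"
  shows "n * card (verts G) = 2 * card (arcs G)"
  using regular_valence[OF assms] unfolding sum_valence[symmetric] by simp

lemma equal_length_eq:
  assumes "normalized G L" "equal_lengths G L" "e \<in> arcs G"
  shows "L e = 1 / real (card (arcs G))"
proof -
  have "L a = L e" if "a \<in> arcs G" for a
    using assms(2,3) that unfolding equal_lengths_def by blast
  then have "(\<Sum>a\<in>arcs G. L a) = (\<Sum>a\<in>arcs G. L e)"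
    by (rule sum.cong[OF refl])
  then have "L e * real (card (arcs G)) = 1"
    using assms(1) unfolding normalized_def by (simp add: mult.commute)
  moreover have "real (card (arcs G)) \<noteq> 0"
    using assms(3) by auto
  ultimately show ?thesis
    by (rule eq_divide_imp[rotated])
qed

end

section \<open>Equal edge lengths\<close>

context metrized_green
begin

lemma equal_length_tau:
  assumes norm: "normalized G L" and eq: "equal_lengths G L" and y: "y \<in> points G L"
  defines "N \<equiv> real (card (arcs G))" and "v \<equiv> real (card (verts G))"
  shows "tau G L y = 1 / 12 - (v - 1) / (6 * N)
      + forest_ratio (verts G) (arcs G) (tail G) (head G) (\<lambda>e. 1 / L e) M / 3" (is ?tau)
    and "4 * forest_ratio (verts G) (arcs G) (tail G) (head G) (\<lambda>e. 1 / L e) M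
      \<ge> (1 + 6 / v) * ((v - 1) / N)\<^sup>2" (is ?lower)
    and "real (edge_connectivity G)
        * forest_ratio (verts G) (arcs G) (tail G) (head G) (\<lambda>e. 1 / L e) M \<le> (v - 1) / N" (is ?upper)
proof -
  let ?B = "forest_ratio (verts G) (arcs G) (tail G) (head G) (\<lambda>e. 1 / L e) M"
  let ?R = "\<lambda>e. R (tail G e) (head G e)"
  define Q where "Q = D (\<lambda>u. M u u) (\<lambda>u. M u u)"
  define W where "W = N * (\<Sum>e\<in>arcs G. (?R e)\<^sup>2)"
  have L: "L e = 1 / N" if "e \<in> arcs G" for e
    using equal_length_eq[OF norm eq that] by (simp add: N_def)
  have N: "0 < N"
    using norm by (auto simp: N_def normalized_def card_gt_0_iff)
  have v: "0 < v" using root_in by (auto simp: v_def card_gt_0_iff)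
  have sumR: "(\<Sum>e\<in>arcs G. ?R e) = (v - 1) / N"
  proof -
    have "N * (\<Sum>e\<in>arcs G. ?R e) = v - 1"
      unfolding v_def foster[symmetric] sum_distrib_left by (intro sum.cong refl) (simp add: L)
    then show ?thesis using N by (simp add: field_simps)
  qed
  have W: "W = (\<Sum>e\<in>arcs G. 1 / L e * (?R e)\<^sup>2)"
    unfolding W_def sum_distrib_left by (intro sum.cong refl) (simp add: L)
  have B: "4 * ?B = W + 3 * Q"
    unfolding forest_ratio_eq W Q_def ..
  have "(\<Sum>e\<in>arcs G. L e * (1 - ?R e / L e)\<^sup>2) = (\<Sum>e\<in>arcs G. 1 / N - 2 * ?R e + N * (?R e)\<^sup>2)"
    using N by (intro sum.cong refl) (simp add: L field_simps power2_eq_square)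
  also have "\<dots> = (\<Sum>e\<in>arcs G. 1 / N) - 2 * (\<Sum>e\<in>arcs G. ?R e) + W"
    unfolding W_def sum_distrib_left sum_subtractf sum.distrib ..
  also have "(\<Sum>e\<in>arcs G. 1 / N) = 1" using N by (simp flip: N_def)
  finally have "tau G L y = 1 / 4 * Q + 1 / 12 * (1 - 2 * ((v - 1) / N) + W)"
    unfolding tau_eq[OF y] Q_def[symmetric] sumR by simp
  moreover have "t = 1 / 12 - X / 6 + b / 3"
    if "t = 1 / 4 * Q + 1 / 12 * (1 - 2 * X + W)" "4 * b = W + 3 * Q" for t X b
    using that by (simp add: field_simps)
  moreover have "(v - 1) / (6 * N) = (v - 1) / N / 6" by simp
  ultimately show ?tau using B by metis
  \<comment> \<open>Cauchy-Schwarz against the constant 1; Foster's identity supplies the sum of the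
    resistances.\<close>
  have "((v - 1) / N)\<^sup>2 \<le> W"
    using Cauchy_Schwarz_ineq_sum[of ?R "\<lambda>_. 1" "arcs G"]
    by (simp add: sumR W_def N_def mult.commute)
  \<comment> \<open>Source of the constant \<open>6 / v\<close>: \<open>Q \<ge> 2 * W / v\<close> is
    inserted into \<open>4 * ?B = W + 3 * Q\<close>.\<close>
  moreover have "2 * W \<le> v * Q"
    using energy_lower_bound unfolding W v_def Q_def .
  then have "2 * W \<le> Q * v" by (simp only: mult.commute)
  then have "(1 + 6 / v) * W \<le> 4 * ?B" unfolding B using v by (simp add: field_simps)
  moreover have "0 \<le> 1 + 6 / v" using v by simp
  ultimately show ?lower
    using mult_left_mono[of "((v - 1) / N)\<^sup>2" W "1 + 6 / v"] by linarith
  \<comment> \<open>Every edge has conductance \<open>N\<close>, so each cut weighs at least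
    \<open>N\<close> times the edge connectivity.\<close>
  have "N * real (edge_connectivity G) * ?B \<le> v - 1"
    unfolding v_def
  proof (rule forest_ratio_cut_bound)
    show "green_network (verts G) (arcs G) (tail G) (head G) (\<lambda>e. 1 / L e) ground M"
      by unfold_locales
    fix S assume S: "S \<subseteq> verts G" "S \<noteq> {}" "S \<noteq> verts G"
    have "(\<Sum>e | e \<in> arcs G \<and> (tail G e \<in> S) \<noteq> (head G e \<in> S). 1 / L e)
        = (\<Sum>e | e \<in> arcs G \<and> (tail G e \<in> S) \<noteq> (head G e \<in> S). N)"
      by (intro sum.cong refl) (simp add: L)
    then show "N * real (edge_connectivity G)
        \<le> (\<Sum>e | e \<in> arcs G \<and> (tail G e \<in> S) \<noteq> (head G e \<in> S). 1 / L e)"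
      using edge_connectivity_le_cut[OF S] N by simp
  qed
  then show ?upper using N by (simp add: field_simps)
qed

end

section \<open>The bounds for tau, in general and for regular graphs\<close>

theorem theorem6p11:
  fixes G :: "('a, 'b) pre_digraph" and L :: "'b weight_fun" and y :: "('a, 'b) point"
    and v e :: nat and g :: int
  assumes "metrized_graph G L"
    and "normalized G L"
    and "bridgeless G"
    and "equal_lengths G L"
    and "v = card (verts G)"
    and "e = card (arcs G)"
    and "g = int e - int v + 1"
    and "y \<in> points G L"
  shows "1/12 - (real v - 1) / (6 * real e)
             + (real v - 1) / (3 * real e * real (edge_connectivity G)) \<ge> tau G L y
       \<and> tau G L y \<ge> 1/12 - (real v - 1) / (6 * real e)
             + (real v + 6) / (12 * real v) * ((real v - 1) / real e)\<^sup>2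
       \<and> (\<forall>n::nat. regular_graph n G L \<and> edge_connectivity G = n \<longrightarrow>
             1/12 - (real v - 1) * (real n - 2) / (3 * real v * (real n)\<^sup>2) \<ge> tau G L y
           \<and> tau G L y \<ge> 1/12 * (real_of_int g / real e)\<^sup>2
                + 1 / (2 * real v) * ((real v - 1) / real e)\<^sup>2)"
proof -
  interpret metrized_graph G L by fact
  obtain ground M where "metrized_green G L ground M" by (rule obtains_green)
  then interpret metrized_green G L ground M .
  define B where "B = forest_ratio (verts G) (arcs G) (tail G) (head G) (\<lambda>e. 1 / L e) M"
  note bounds = equal_length_tau[OF assms(2,4,8), folded B_def assms(5,6)]
  have epos: "0 < real e"
    using assms(2) by (auto simp: assms(6) normalized_def card_gt_0_iff)
  have vpos: "0 < v" using root_in by (auto simp: assms(5) card_gt_0_iff)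
  have upper: "tau G L y \<le> 1/12 - (real v - 1) / (6 * real e)
      + (real v - 1) / (3 * real e * real (edge_connectivity G))"
  \<comment> \<open>For a single vertex the edge connectivity has the default value 0, but the
    forest ratio and \<open>v - 1\<close> vanish too, so the bound is an equality. Otherwise
    bridgelessness makes the divisor positive.\<close>
  proof (cases "v = 1")
    case True
    then obtain u where V: "verts G = {u}" using assms(5) by (auto simp: card_1_singleton_iff)
    then have "ground = u" using root_in by simp
    then have "B = 0"
      using V green_root src_in tgt_in unfolding B_def forest_ratio_def by (auto intro!: sum.neutral)
    then show ?thesis using bounds(1) True by simp
  next
    case False
    then have "2 \<le> edge_connectivity G"
      using edge_connectivity_ge_2[OF assms(3)] vpos assms(5) by simp
    then have "B \<le> (real v - 1) / real e / real (edge_connectivity G)"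
      using bounds(3) by (subst pos_le_divide_eq) (simp_all add: mult.commute)
    then have "B / 3 \<le> (real v - 1) / real e / real (edge_connectivity G) / 3"
      by (rule divide_right_mono) simp
    also have "\<dots> = (real v - 1) / (3 * real e * real (edge_connectivity G))"
      by (simp add: mult_ac)
    finally show ?thesis unfolding bounds(1) by (rule add_left_mono)
  qed
  have "(real v + 6) / (12 * real v) * ((real v - 1) / real e)\<^sup>2
      = (1 + 6 / real v) * ((real v - 1) / real e)\<^sup>2 / 12"
    using vpos by (simp add: field_simps)
  also have "\<dots> \<le> (4 * B) / 12"
    using bounds(2) by (rule divide_right_mono) simp
  also have "\<dots> = B / 3" by simp
  finally have lower: "1/12 - (real v - 1) / (6 * real e)
      + (real v + 6) / (12 * real v) * ((real v - 1) / real e)\<^sup>2 \<le> tau G L y"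
    unfolding bounds(1) by (rule add_left_mono)
  \<comment> \<open>With \<open>g / e = 1 - (v - 1) / e\<close> the square is completed, and
    \<open>(v + 6) / (12 * v)\<close> splits as \<open>1 / 12 + 1 / (2 * v)\<close>.\<close>
  have "1/12 - (real v - 1) / (6 * real e) + (real v + 6) / (12 * real v) * ((real v - 1) / real e)\<^sup>2
      = 1/12 * (real_of_int g / real e)\<^sup>2 + 1 / (2 * real v) * ((real v - 1) / real e)\<^sup>2"
    using vpos epos by (simp add: assms(7) field_simps power2_eq_square)
  then have lower': "1/12 * (real_of_int g / real e)\<^sup>2 + 1 / (2 * real v) * ((real v - 1) / real e)\<^sup>2
      \<le> tau G L y"
    using lower by simp
  have upper': "tau G L y \<le> 1/12 - (real v - 1) * (real n - 2) / (3 * real v * (real n)\<^sup>2)"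
    if "regular_graph n G L" "edge_connectivity G = n" for n
  proof -
    \<comment> \<open>The handshake count eliminates \<open>e\<close> from the general upper bound;
      as \<open>e > 0\<close>, it also gives \<open>n > 0\<close>.\<close>
    have nv: "n * v = 2 * e"
      using regular_card_arcs[OF that assms(3)] assms(5,6) by simp
    then have "0 < n" using epos by (cases n) auto
    have e_eq: "real e = real n * real v / 2"
      using arg_cong[OF nv, of real] by simp
    have "1/12 - (real v - 1) / (6 * real e) + (real v - 1) / (3 * real e * real n)
        = 1/12 - (real v - 1) * (real n - 2) / (3 * real v * (real n)\<^sup>2)"
      using vpos \<open>0 < n\<close> unfolding e_eq by (simp add: field_simps power2_eq_square)
    then show ?thesis using upper that(2) by simp
  qed
  show ?thesis using upper lower lower' upper' by blast
qed

end
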